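(* Let $(F,G)\in\mathcal{H}_{\mathbf d}[q+s]$ with $q\le n+1$ and $s=\#G$, assume $\kappa^*(F,G)<\infty$, and set $B_s=\sum_{i=0}^{s-1}(4D)^i=\frac{(4D)^s-1}{4D-1}$. Let $x\in\mathbb{S}^n$ and let $r$ be a positive number with $r<\frac{1}{13D^{3/2}\kappa(F,G,x)^2}$. If $x\in\mathrm{Approx}(F,G,r)$, then $d_{\mathbb{S}}(x,S(F,G))<3B_s\,\kappa(F,G,x)\,r$.
   Context: $\mathbb{S}^n\subset\mathbb{R}^{n+1}$ is the unit sphere with geodesic distance $d_{\mathbb S}$. $\mathcal{H}_{\mathbf d}[m]$ is the space of $m$-tuples of real homogeneous polynomials in $X_0,\dots,X_n$ of degrees $d_1,\dots,d_m$; $D=\max_i d_i$. Weyl inner product: $\langle h,h'\rangle=\sum_{|a|=d}\binom{d}{a}h_ah'_a$, $\langle F,F'\rangle=\sum_j\langle f_j,f'_j\rangle$, $\|\cdot\|$ the induced norm; $\Delta=\mathrm{diag}(\sqrt{d_1},\dots,\sqrt{d_m})$. For $x\in\mathbb{S}^n$, $\mu_{proj}(F,x)=\|F\|\,\|(DF(x)|_{x^\perp})^{+}\Delta\|$ (spectral norm, pseudoinverse) if $DF(x)|_{x^\perp}$ is surjective, else $\infty$; $\kappa(F,x)=(\mu_{proj}(F,x)^{-2}+\|F(x)\|^2/\|F\|^2)^{-1/2}$ with $\infty^{-1}=0$, $0^{-1}=\infty$, $\kappa(0,x)=\infty$; $\kappa(F)=\max_x\kappa(F,x)$. For $F=(f_1,\dots,f_q)$,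 $G=(g_1,\dots,g_s)$ and subtuple $L\subset G$, $F^L$ is $F$ with $L$ appended; $\kappa^*(F,G)=\max_{L\subset G,\ q+|L|\le n+1}\kappa(F^L)$, $\kappa(F,G,x)=\max_{L\subset G,\ q+|L|\le n+1}\kappa(F^L,x)$. $S(F,G)=\{x\in\mathbb{S}^n\mid f_i(x)=0\ \forall i,\ g_j(x)\ge0\ \forall j\}$ and $\mathrm{Approx}(F,G,r)=\{x\in\mathbb{S}^n\mid |f(x)|<\|f\|r\ \forall f\in F,\ g(x)>-\|g\|r\ \forall g\in G\}$.
   Formalization: Assumes s ≥ 1 and D ≥ 1: for s = 0, B_0 = 0 and the claim d < 0 is false (e.g. n = 1, F = (X_0), x = e_1); for D = 0 the bound on r divides by zero. For q = 0 the empty tuple is given condition number 0, not infinity. *)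

theory Defs
  imports "HOL-Analysis.Analysis" "HOL-Library.Poly_Mapping"
begin

text \<open>
  The variables are indexed by a finite type, so that the number n + 1 of variables
  \<open>X\<^sub>0, \<dots>, X\<^sub>n\<close> is \<open>CARD('n)\<close> and the sphere is \<open>sphere 0 1\<close> in \<open>real ^ 'n\<close>.
  A polynomial is its finitely supported family of coefficients over the exponents \<open>'n \<Rightarrow> nat\<close>.
\<close>

type_synonym 'n mpol = "('n \<Rightarrow> nat) \<Rightarrow>\<^sub>0 real"

definition peval :: "'n::finite mpol \<Rightarrow> real ^ 'n \<Rightarrow> real" where
  "peval p x = (\<Sum>a\<in>Poly_Mapping.keys p. Poly_Mapping.lookup p a * (\<Prod>i\<in>UNIV. (x $ i) ^ a i))"

definition homogeneous_of_degree :: "nat \<Rightarrow> 'n::finite mpol \<Rightarrow> bool" where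
  "homogeneous_of_degree d p \<longleftrightarrow> (\<forall>a\<in>Poly_Mapping.keys p. sum a UNIV = d)"

definition multinomial :: "nat \<Rightarrow> ('n::finite \<Rightarrow> nat) \<Rightarrow> real" where
  "multinomial d a = fact d / (\<Prod>i\<in>UNIV. fact (a i))"

text \<open>
  In the Weyl inner product, the coefficients \<open>h\<^sub>a\<close> of a form h of degree d are the normalised
  ones, for which h is the sum of \<open>multinomial d a * h\<^sub>a * X\<^sup>a\<close> over the exponents a.
\<close>

definition weyl_coeff :: "nat \<Rightarrow> 'n::finite mpol \<Rightarrow> ('n \<Rightarrow> nat) \<Rightarrow> real" where
  "weyl_coeff d p a = Poly_Mapping.lookup p a / multinomial d a"

definition weyl_inner :: "nat \<Rightarrow> 'n::finite mpol \<Rightarrow> 'n mpol \<Rightarrow> real" where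
  "weyl_inner d p p' =
     (\<Sum>a\<in>{a. sum a UNIV = d}. multinomial d a * weyl_coeff d p a * weyl_coeff d p' a)"

text \<open>
  The zero polynomial is homogeneous of every degree, so each member of a system is stored
  together with its prescribed degree.
\<close>

type_synonym 'n form = "nat \<times> 'n mpol"
type_synonym 'n system = "'n form list"

definition homogeneous_system :: "'n::finite system \<Rightarrow> bool" where
  "homogeneous_system F \<longleftrightarrow> (\<forall>(d, p)\<in>set F. homogeneous_of_degree d p)"

definition max_degree :: "'n::finite system \<Rightarrow> nat" where
  "max_degree F = Max (fst ` set F)"

definition feval :: "'n::finite form \<Rightarrow> real ^ 'n \<Rightarrow> real" where
  "feval f x = peval (snd f) x"

definition form_norm :: "'n::finite form \<Rightarrow> real" where
  "form_norm f = sqrt (weyl_inner (fst f) (snd f) (snd f))"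

definition system_inner :: "'n::finite system \<Rightarrow> 'n system \<Rightarrow> real" where
  "system_inner F F' = (\<Sum>j<length F. weyl_inner (fst (F ! j)) (snd (F ! j)) (snd (F' ! j)))"

definition system_norm :: "'n::finite system \<Rightarrow> real" where
  "system_norm F = sqrt (system_inner F F)"

text \<open>
  Vectors with m entries, for m the length of a system, are functions \<open>nat \<Rightarrow> real\<close> of which only
  the values on \<open>{..<m}\<close> matter, with Euclidean norm \<open>L2_set y {..<m}\<close>.
\<close>

definition value_norm :: "'n::finite system \<Rightarrow> real ^ 'n \<Rightarrow> real" where
  "value_norm F x = L2_set (\<lambda>j. feval (F ! j) x) {..<length F}"

definition system_deriv :: "'n::finite system \<Rightarrow> real ^ 'n \<Rightarrow> real ^ 'n \<Rightarrow> nat \<Rightarrow> real" where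
  "system_deriv F x v j = frechet_derivative (feval (F ! j)) (at x) v"

definition tangent_space :: "real ^ 'n::finite \<Rightarrow> (real ^ 'n) set" where
  "tangent_space x = {v. x \<bullet> v = 0}"

definition surj_on_coords :: "'a set \<Rightarrow> nat \<Rightarrow> ('a \<Rightarrow> nat \<Rightarrow> real) \<Rightarrow> bool" where
  "surj_on_coords V m A \<longleftrightarrow> (\<forall>y. \<exists>v\<in>V. \<forall>j<m. A v j = y j)"

text \<open>
  The Moore--Penrose pseudoinverse, applied to y, of a linear map A from the subspace V to
  vectors with m entries: the least-squares solution of \<open>A v = y\<close> orthogonal to the kernel of A.
\<close>

definition pinv :: "'a::euclidean_space set \<Rightarrow> nat \<Rightarrow> ('a \<Rightarrow> nat \<Rightarrow> real) \<Rightarrow> (nat \<Rightarrow> real) \<Rightarrow> 'a" where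
  "pinv V m A y = (THE v. v \<in> V
     \<and> (\<forall>w\<in>V. (\<forall>j<m. A w j = 0) \<longrightarrow> v \<bullet> w = 0)
     \<and> (\<forall>w\<in>V. L2_set (\<lambda>j. A v j - y j) {..<m} \<le> L2_set (\<lambda>j. A w j - y j) {..<m}))"

definition mu_proj :: "'n::finite system \<Rightarrow> real ^ 'n \<Rightarrow> ereal" where
  "mu_proj F x =
     (let m = length F; V = tangent_space x; A = system_deriv F x in
      if surj_on_coords V m A then
        ereal (system_norm F) *
        (SUP y\<in>{y. L2_set y {..<m} \<le> 1}.
           ereal (norm (pinv V m A (\<lambda>j. sqrt (real (fst (F ! j))) * y j))))
      else \<infinity>)"

text \<open>The power \<open>t\<^sup>-\<^sup>1\<^sup>/\<^sup>2\<close> on the extended nonnegative reals.\<close>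

definition inv_sqrt :: "ereal \<Rightarrow> ereal" where
  "inv_sqrt t = (if t = 0 then \<infinity> else if t = \<infinity> then 0 else ereal (1 / sqrt (real_of_ereal t)))"

text \<open>
  The convention \<open>\<kappa>(0, x) = \<infinity>\<close> concerns systems with at least one member; it is not applied to
  the empty system, for which \<open>mu_proj\<close> is 0 and the formula below gives \<open>\<kappa> = 0\<close>.  Otherwise a
  system given by inequalities only would always have infinite condition number.
\<close>

definition kappa_at :: "'n::finite system \<Rightarrow> real ^ 'n \<Rightarrow> ereal" where
  "kappa_at F x =
     (if F \<noteq> [] \<and> (\<forall>f\<in>set F. snd f = 0) then \<infinity>
      else inv_sqrt ((inverse (mu_proj F x))\<^sup>2 + ereal ((value_norm F x)\<^sup>2 / (system_norm F)\<^sup>2)))"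

definition kappa :: "'n::finite system \<Rightarrow> ereal" where
  "kappa F = (SUP x\<in>sphere 0 1. kappa_at F x)"

text \<open>Subtuples L of G are given by sets of positions; \<open>F @ nths G L\<close> is F with L appended.\<close>

definition admissible :: "'n::finite system \<Rightarrow> 'n system \<Rightarrow> nat set set" where
  "admissible F G = {L. L \<subseteq> {..<length G} \<and> length F + card L \<le> CARD('n)}"

definition kappa_star :: "'n::finite system \<Rightarrow> 'n system \<Rightarrow> ereal" where
  "kappa_star F G = Max ((\<lambda>L. kappa (F @ nths G L)) ` admissible F G)"

definition kappa_pair_at :: "'n::finite system \<Rightarrow> 'n system \<Rightarrow> real ^ 'n \<Rightarrow> ereal" where
  "kappa_pair_at F G x = Max ((\<lambda>L. kappa_at (F @ nths G L) x) ` admissible F G)"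

definition semialg_set :: "'n::finite system \<Rightarrow> 'n system \<Rightarrow> (real ^ 'n) set" where
  "semialg_set F G =
     {x \<in> sphere 0 1. (\<forall>f\<in>set F. feval f x = 0) \<and> (\<forall>g\<in>set G. feval g x \<ge> 0)}"

definition approx_semialg_set :: "'n::finite system \<Rightarrow> 'n system \<Rightarrow> real \<Rightarrow> (real ^ 'n) set" where
  "approx_semialg_set F G r =
     {x \<in> sphere 0 1. (\<forall>f\<in>set F. \<bar>feval f x\<bar> < form_norm f * r) \<and>
        (\<forall>g\<in>set G. feval g x > - form_norm g * r)}"

definition sphere_dist :: "real ^ 'n::finite \<Rightarrow> real ^ 'n \<Rightarrow> real" where
  "sphere_dist x y = arccos (x \<bullet> y)"

text \<open>Extended real valued, so that the distance to the empty set is \<open>\<infinity>\<close>, unlike for \<open>infdist\<close>.\<close>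

definition sphere_setdist :: "real ^ 'n::finite \<Rightarrow> (real ^ 'n) set \<Rightarrow> ereal" where
  "sphere_setdist x S = (INF y\<in>S. ereal (sphere_dist x y))"

end

theory Submission
  imports Defs "HOL-Combinatorics.Multiset_Permutations"
begin

text \<open>
  Let \<open>\<phi>(y)\<close> be the largest normalised violation of a constraint at \<open>y\<close>, so that
  \<open>\<phi>(x) < r\<close> and the zeros of \<open>\<phi>\<close> on the sphere are the points of \<open>semialg_set F G\<close>. With
  \<open>c = 3\<kappa>/2\<close>, a minimiser \<open>y\<close> of \<open>\<phi>(y) + |y - x| / c\<close> on the sphere satisfies \<open>|y - x| < c r\<close>.
  If \<open>\<phi>(y) > 0\<close>, let \<open>M\<close> be the system F extended by the active members of G. All of M is small
  at \<open>x\<close>, so the condition number bounds the pseudoinverse of its derivative at \<open>x\<close>; Lipschitz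
  bounds for the gradients carry this over to \<open>y\<close>, where it says that the convex hull of the
  normalised tangential gradients stays at distance more than \<open>1/c\<close> from 0. Hence some tangent
  direction decreases all active constraints at a rate exceeding \<open>1/c\<close>, contradicting the choice
  of \<open>y\<close>. So \<open>\<phi>(y) = 0\<close>; as the geodesic distance is at most twice the chord, it is
  less than \<open>3\<kappa>r\<close>, which suffices since \<open>B \<ge> 1\<close>.
\<close>

section \<open>Forms as symmetric tensors\<close>

text \<open>Words index the entries of a tensor of order \<open>d\<close> on the variables. Passing
  from exponents to words makes a form the diagonal restriction of a multilinear map.\<close>

definition words :: "nat \<Rightarrow> 'n list set" where
  "words d = {xs. length xs = d}"

definition letter_counts :: "'n list \<Rightarrow> 'n \<Rightarrow> nat" where
  "letter_counts xs = count (mset xs)"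

lemma finite_words [simp]: "finite (words d :: 'n::finite list set)"
  using finite_lists_length_eq[of "UNIV :: 'n set" d] by (simp add: words_def)

lemma sum_words_0: "sum f (words 0) = f []"
  by (simp add: words_def)

lemma sum_words_Suc:
  fixes f :: "'n::finite list \<Rightarrow> real"
  shows "sum f (words (Suc d)) = (\<Sum>i\<in>UNIV. \<Sum>xs\<in>words d. f (i # xs))"
proof -
  have "sum f (words (Suc d)) = (\<Sum>(i, xs)\<in>UNIV \<times> words d. f (i # xs))"
    by (rule sum.reindex_bij_witness[of _ "\<lambda>(i, xs). i # xs" "\<lambda>xs. (hd xs, tl xs)"])
      (auto simp: words_def length_Suc_conv)
  then show ?thesis by (simp add: sum.cartesian_product)
qed

text \<open>The words with letter counts \<open>a\<close> are the permutations of the multiset with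
  multiplicities \<open>a\<close>, which the multinomial coefficient counts.\<close>

lemma card_words_with_counts:
  fixes a :: "'n::finite \<Rightarrow> nat"
  assumes "sum a UNIV = d"
  shows "real (card {xs \<in> words d. letter_counts xs = a}) = multinomial d a"
    and "a \<in> letter_counts ` words d"
proof -
  define A where "A = Abs_multiset a"
  have cA: "count A = a" by (simp add: A_def Abs_multiset_inverse)
  have sA: "size A = d"
  proof -
    have "size A = sum (count A) (set_mset A)" by (simp add: size_multiset_overloaded_eq)
    also have "\<dots> = sum (count A) UNIV"
      by (rule sum.mono_neutral_left) (auto simp: not_in_iff)
    finally show ?thesis using assms cA by simp
  qed
  have eq: "{xs \<in> words d. letter_counts xs = a} = permutations_of_multiset A"
    unfolding words_def letter_counts_def permutations_of_multiset_def cA[symmetric] count_inject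
    using sA by (auto simp flip: size_mset)
  have pr: "(\<Prod>x\<in>set_mset A. fact (count A x)) = (\<Prod>x\<in>UNIV. fact (a x) :: nat)"
    unfolding cA by (rule prod.mono_neutral_left) (auto simp: not_in_iff cA[symmetric])
  show "real (card {xs \<in> words d. letter_counts xs = a}) = multinomial d a"
    unfolding eq multinomial_def
    using card_permutations_of_multiset(2)[of A]
    by (simp add: card_permutations_of_multiset(1) real_of_nat_div pr sA)
  obtain xs where "mset xs = A" using ex_mset by blast
  then have "xs \<in> words d" "letter_counts xs = a"
    using cA sA by (auto simp: words_def letter_counts_def)
  then show "a \<in> letter_counts ` words d" by blast
qed

lemma sum_letter_counts:
  fixes xs :: "'n::finite list"
  shows "sum (letter_counts xs) UNIV = length xs"
proof -
  have "size (mset xs) = sum (count (mset xs)) UNIV"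
    unfolding size_multiset_overloaded_eq
    by (rule sum.mono_neutral_left) (auto simp: not_in_iff[symmetric])
  then show ?thesis by (simp add: letter_counts_def)
qed

lemma exponents_eq_letter_counts:
  "{a :: 'n::finite \<Rightarrow> nat. sum a UNIV = d} = letter_counts ` words d"
  using card_words_with_counts(2) by (auto simp: sum_letter_counts words_def)

lemma finite_exponents [simp]: "finite {a :: 'n::finite \<Rightarrow> nat. sum a UNIV = d}"
  by (simp add: exponents_eq_letter_counts)

text \<open>Grouping the words by their counts turns the multinomial weights of the Weyl product
  into multiplicities.\<close>

lemma sum_words_letter_counts:
  fixes h :: "('n::finite \<Rightarrow> nat) \<Rightarrow> real"
  shows "(\<Sum>xs\<in>words d. h (letter_counts xs)) = (\<Sum>a | sum a UNIV = d. multinomial d a * h a)"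
proof -
  have "(\<Sum>xs\<in>words d. h (letter_counts xs)) =
      (\<Sum>a | sum a UNIV = d. \<Sum>xs | xs \<in> words d \<and> letter_counts xs = a. h (letter_counts xs))"
    by (rule sum.group[symmetric]) (auto simp: exponents_eq_letter_counts)
  also have "\<dots> = (\<Sum>a | sum a UNIV = d. multinomial d a * h a)"
    by (intro sum.cong) (auto simp: card_words_with_counts(1)[symmetric])
  finally show ?thesis .
qed

lemma prod_word:
  fixes f :: "'n::finite \<Rightarrow> real"
  shows "(\<Prod>k<length xs. f (xs ! k)) = (\<Prod>i\<in>UNIV. f i ^ letter_counts xs i)"
proof (induction xs)
  case Nil
  then show ?case by (simp add: letter_counts_def)
next
  case (Cons y ys)
  have "(\<Prod>i\<in>UNIV. f i ^ letter_counts (y # ys) i) =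
      (\<Prod>i\<in>UNIV. (if i = y then f i else 1) * f i ^ letter_counts ys i)"
    by (intro prod.cong) (auto simp: letter_counts_def)
  also have "\<dots> = f y * (\<Prod>i\<in>UNIV. f i ^ letter_counts ys i)"
    by (simp add: prod.distrib)
  finally show ?case using Cons.IH by (simp add: prod.lessThan_Suc_shift del: prod.lessThan_Suc)
qed

section \<open>Multilinear maps given by their coefficient tensors\<close>

definition mform :: "('n::finite list \<Rightarrow> real) \<Rightarrow> nat \<Rightarrow> (nat \<Rightarrow> real ^ 'n) \<Rightarrow> real" where
  "mform c d V = (\<Sum>xs\<in>words d. c xs * (\<Prod>k<d. V k $ (xs ! k)))"

lemma multinomial_nonzero [simp]: "multinomial d a \<noteq> 0"
  by (simp add: multinomial_def)

text \<open>The multinomial factor divided out in \<open>weyl_coeff\<close> is restored by the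
  number of words belonging to each exponent.\<close>

lemma peval_eq_mform:
  fixes p :: "'n::finite mpol"
  assumes "homogeneous_of_degree d p"
  shows "peval p x = mform (\<lambda>xs. weyl_coeff d p (letter_counts xs)) d (\<lambda>_. x)"
proof -
  have "peval p x = (\<Sum>a | sum a UNIV = d. Poly_Mapping.lookup p a * (\<Prod>i\<in>UNIV. (x $ i) ^ a i))"
    unfolding peval_def
    by (rule sum.mono_neutral_left)
      (use assms in \<open>auto simp: homogeneous_of_degree_def in_keys_iff\<close>)
  also have "\<dots> = (\<Sum>a | sum a UNIV = d. multinomial d a *
      (weyl_coeff d p a * (\<Prod>i\<in>UNIV. (x $ i) ^ a i)))"
    by (intro sum.cong) (auto simp: weyl_coeff_def)
  also have "\<dots> = (\<Sum>xs\<in>words d. weyl_coeff d p (letter_counts xs) *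
      (\<Prod>i\<in>UNIV. (x $ i) ^ letter_counts xs i))"
    by (rule sum_words_letter_counts[symmetric])
  also have "\<dots> = mform (\<lambda>xs. weyl_coeff d p (letter_counts xs)) d (\<lambda>_. x)"
    unfolding mform_def
    by (intro sum.cong) (auto simp: words_def prod_word[symmetric])
  finally show ?thesis .
qed

lemma weyl_inner_eq_sum_words:
  fixes p :: "'n::finite mpol"
  shows "weyl_inner d p p = (\<Sum>xs\<in>words d. (weyl_coeff d p (letter_counts xs))\<^sup>2)"
  unfolding weyl_inner_def
  by (subst sum_words_letter_counts[of "\<lambda>a. (weyl_coeff d p a)\<^sup>2"])
    (simp add: power2_eq_square mult.assoc)

lemma sum_words_prod:
  fixes V :: "nat \<Rightarrow> 'n::finite \<Rightarrow> real"
  shows "(\<Sum>xs\<in>words d. \<Prod>k<d. V k (xs ! k)) = (\<Prod>k<d. \<Sum>i\<in>UNIV. V k i)"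
proof (induction d arbitrary: V)
  case 0
  show ?case by (subst sum_words_0) simp
next
  case (Suc d)
  have "(\<Sum>xs\<in>words (Suc d). \<Prod>k<Suc d. V k (xs ! k)) =
      (\<Sum>i\<in>UNIV. V 0 i * (\<Sum>xs\<in>words d. \<Prod>k<d. V (Suc k) (xs ! k)))"
    by (simp add: sum_words_Suc prod.lessThan_Suc_shift sum_distrib_left del: prod.lessThan_Suc)
  then show ?case
    using Suc.IH[of "\<lambda>k. V (Suc k)"]
    by (simp add: prod.lessThan_Suc_shift sum_distrib_right[symmetric] del: prod.lessThan_Suc)
qed

text \<open>Cauchy-Schwarz against the rank-one tensor with entries
  \<open>\<Prod>k<d. V k $ (xs ! k)\<close>, whose Frobenius norm factors into the norms of the
  \<open>V k\<close>.\<close>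

lemma abs_mform_le:
  "\<bar>mform c d V\<bar> \<le> sqrt (\<Sum>xs\<in>words d. (c xs)\<^sup>2) * (\<Prod>k<d. norm (V k))"
proof -
  have "(mform c d V)\<^sup>2 \<le> (\<Sum>xs\<in>words d. (c xs)\<^sup>2) * (\<Sum>xs\<in>words d. (\<Prod>k<d. V k $ (xs ! k))\<^sup>2)"
    unfolding mform_def by (rule Cauchy_Schwarz_ineq_sum)
  also have "(\<Sum>xs\<in>words d. (\<Prod>k<d. V k $ (xs ! k))\<^sup>2) = (\<Prod>k<d. \<Sum>i\<in>UNIV. (V k $ i)\<^sup>2)"
    unfolding prod_power_distrib
    by (rule sum_words_prod[of "\<lambda>k i. (V k $ i)\<^sup>2"])
  also have "\<dots> = (\<Prod>k<d. norm (V k))\<^sup>2"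
    by (simp add: prod_power_distrib norm_vec_def L2_set_def sum_nonneg)
  finally have "\<bar>mform c d V\<bar> \<le> sqrt ((\<Sum>xs\<in>words d. (c xs)\<^sup>2) * (\<Prod>k<d. norm (V k))\<^sup>2)"
    by (metis real_sqrt_abs real_sqrt_le_iff)
  then show ?thesis
    by (simp add: real_sqrt_mult prod_nonneg)
qed

lemma prod_fun_upd:
  fixes V :: "nat \<Rightarrow> real ^ 'n::finite"
  assumes "j < d"
  shows "(\<Prod>k<d. (V(j := v)) k $ (xs ! k)) = v $ (xs ! j) * (\<Prod>k\<in>{..<d} - {j}. V k $ (xs ! k))"
proof -
  have "(\<Prod>k\<in>{..<d} - {j}. (V(j := v)) k $ (xs ! k)) = (\<Prod>k\<in>{..<d} - {j}. V k $ (xs ! k))"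
    by (rule prod.cong) auto
  then show ?thesis using assms by (subst prod.remove[of _ j]) auto
qed

lemma mform_upd_diff:
  assumes "j < d"
  shows "mform c d (V(j := v)) - mform c d (V(j := w)) = mform c d (V(j := v - w))"
  unfolding mform_def prod_fun_upd[OF assms]
  by (simp add: sum_subtractf[symmetric] algebra_simps)

text \<open>The arguments are exchanged one at a time; by multilinearity each exchange costs the
  norm of one difference, the other arguments having norm at most 1.\<close>

lemma mform_diff_le:
  fixes V W :: "nat \<Rightarrow> real ^ 'n::finite"
  assumes V: "\<And>k. k < d \<Longrightarrow> norm (V k) \<le> 1" and W: "\<And>k. k < d \<Longrightarrow> norm (W k) \<le> 1"
  shows "\<bar>mform c d V - mform c d W\<bar> \<le>
    sqrt (\<Sum>xs\<in>words d. (c xs)\<^sup>2) * (\<Sum>k<d. norm (V k - W k))"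
proof -
  define C where "C = sqrt (\<Sum>xs\<in>words d. (c xs)\<^sup>2)"
  have C0: "C \<ge> 0" by (simp add: C_def sum_nonneg)
  \<comment> \<open>The hybrid family: the first \<open>m\<close> arguments are already exchanged,
    so it runs from \<open>V\<close> at \<open>m = 0\<close> to \<open>W\<close> at
    \<open>m = d\<close>.\<close>
  define U where "U m = (\<lambda>k. if k < m then W k else V k)" for m
  have step: "\<bar>mform c d (U m) - mform c d (U (Suc m))\<bar> \<le> C * norm (V m - W m)" if "m < d" for m
  proof -
    have "U m = (U m)(m := V m)" "U (Suc m) = (U m)(m := W m)"
      by (auto simp: U_def fun_eq_iff)
    then have "mform c d (U m) - mform c d (U (Suc m)) = mform c d ((U m)(m := V m - W m))"
      using mform_upd_diff[OF that] by metis
    also have "\<bar>\<dots>\<bar> \<le> C * (\<Prod>k<d. norm (((U m)(m := V m - W m)) k))"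
      unfolding C_def by (rule abs_mform_le)
    also have "(\<Prod>k<d. norm (((U m)(m := V m - W m)) k)) =
        norm (V m - W m) * (\<Prod>k\<in>{..<d} - {m}. norm (((U m)(m := V m - W m)) k))"
      using that by (subst prod.remove[of _ m]) auto
    also have "\<dots> \<le> norm (V m - W m) * 1"
      by (intro mult_left_mono prod_le_1) (auto simp: U_def V W)
    finally show ?thesis using C0 by (simp add: mult_left_mono)
  qed
  have tel: "\<bar>mform c d (U 0) - mform c d (U n)\<bar> \<le> C * (\<Sum>k<n. norm (V k - W k))" if "n \<le> d" for n
    using that
  proof (induction n)
    case (Suc n)
    then show ?case using step[of n] by (auto simp: distrib_left)
  qed simp
  have "mform c d (U d) = mform c d W" "mform c d (U 0) = mform c d V"
    by (simp_all add: mform_def U_def)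
  then show ?thesis using tel[of d] by (simp add: C_def)
qed

text \<open>Product rule: each argument position in turn receives the direction
  \<open>v\<close>.\<close>

lemma has_derivative_mform:
  fixes c :: "'n::finite list \<Rightarrow> real"
  shows "((\<lambda>x. mform c d (\<lambda>_. x)) has_derivative (\<lambda>v. \<Sum>j<d. mform c d ((\<lambda>_. x)(j := v)))) (at x)"
proof -
  have eq: "(\<Sum>j<d. mform c d ((\<lambda>_. x)(j := v))) =
      (\<Sum>xs\<in>words d. c xs * (\<Sum>j<d. v $ (xs ! j) * (\<Prod>k\<in>{..<d} - {j}. x $ (xs ! k))))" for v
    unfolding mform_def
    by (subst sum.swap) (intro sum.cong, simp_all add: prod_fun_upd sum_distrib_left del: fun_upd_apply)
  have nth: "((\<lambda>x :: real ^ 'n. x $ i) has_derivative (\<lambda>v. v $ i)) (at x)" for i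
    by (rule bounded_linear.has_derivative[OF bounded_linear_vec_nth, OF has_derivative_ident])
  show ?thesis
    unfolding eq unfolding mform_def
    by (intro has_derivative_sum has_derivative_mult_right has_derivative_prod nth)
qed

section \<open>Bounds for forms and their gradients\<close>

text \<open>The adjoint of a linear functional, applied to 1, is the vector that represents it by
  the inner product.\<close>

definition form_gradient :: "'n::finite form \<Rightarrow> real ^ 'n \<Rightarrow> real ^ 'n" where
  "form_gradient f x = adjoint (frechet_derivative (feval f) (at x)) 1"

abbreviation homogeneous_form :: "'n::finite form \<Rightarrow> bool" where
  "homogeneous_form f \<equiv> homogeneous_of_degree (fst f) (snd f)"

text \<open>
  The entries of the symmetric tensor \<open>T\<close> with \<open>f(x) = T(x, \<dots>, x)\<close>. Its Frobenius norm is the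
  Weyl norm, since \<open>multinomial d a\<close> words have the letter counts \<open>a\<close>.
\<close>

definition form_tensor :: "'n::finite form \<Rightarrow> 'n list \<Rightarrow> real" where
  "form_tensor f xs = weyl_coeff (fst f) (snd f) (letter_counts xs)"

lemma feval_eq_mform:
  assumes "homogeneous_form f"
  shows "feval f x = mform (form_tensor f) (fst f) (\<lambda>_. x)"
  unfolding feval_def peval_eq_mform[OF assms] form_tensor_def ..

lemma form_norm_eq: "form_norm f = sqrt (\<Sum>xs\<in>words (fst f). (form_tensor f xs)\<^sup>2)"
  by (simp add: form_norm_def weyl_inner_eq_sum_words form_tensor_def)

lemma form_norm_nonneg [simp]: "form_norm f \<ge> 0"
  by (simp add: form_norm_eq sum_nonneg)

lemma has_derivative_feval_mform:
  assumes "homogeneous_form f"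
  shows "(feval f has_derivative
    (\<lambda>v. \<Sum>j<fst f. mform (form_tensor f) (fst f) ((\<lambda>_. x)(j := v)))) (at x)"
  using has_derivative_mform feval_eq_mform[OF assms, abs_def] by simp

lemma frechet_derivative_feval:
  assumes "homogeneous_form f"
  shows "frechet_derivative (feval f) (at x) =
    (\<lambda>v. \<Sum>j<fst f. mform (form_tensor f) (fst f) ((\<lambda>_. x)(j := v)))"
  using frechet_derivative_at[OF has_derivative_feval_mform[OF assms]] by simp

lemma inner_form_gradient:
  assumes "homogeneous_form f"
  shows "form_gradient f x \<bullet> v = frechet_derivative (feval f) (at x) v"
proof -
  have "linear (frechet_derivative (feval f) (at x))"
    using has_derivative_feval_mform[OF assms]
    by (intro linear_frechet_derivative) (auto simp: differentiable_def)
  from adjoint_works[OF this, of v 1] show ?thesis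
    by (simp add: form_gradient_def inner_commute)
qed

lemma has_derivative_feval:
  assumes "homogeneous_form f"
  shows "(feval f has_derivative (\<lambda>v. form_gradient f x \<bullet> v)) (at x)"
  using has_derivative_feval_mform[OF assms]
  by (simp add: inner_form_gradient[OF assms] frechet_derivative_feval[OF assms])

lemma abs_feval_le:
  assumes "homogeneous_form f" "norm x = 1"
  shows "\<bar>feval f x\<bar> \<le> form_norm f"
  using abs_mform_le[of "form_tensor f" "fst f" "\<lambda>_. x"] assms
  by (simp add: feval_eq_mform form_norm_eq)

lemma feval_diff_le:
  assumes "homogeneous_form f" "norm x = 1" "norm y = 1"
  shows "\<bar>feval f x - feval f y\<bar> \<le> real (fst f) * form_norm f * norm (x - y)"
  using mform_diff_le[of "fst f" "\<lambda>_. x" "\<lambda>_. y" "form_tensor f"] assms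
  by (simp add: feval_eq_mform form_norm_eq mult_ac)

text \<open>Euler's identity: inserting \<open>x\<close> into any position gives back the form, so
  all summands of the derivative coincide.\<close>

lemma form_gradient_self:
  assumes "homogeneous_form f"
  shows "form_gradient f x \<bullet> x = real (fst f) * feval f x"
  by (simp add: inner_form_gradient frechet_derivative_feval assms feval_eq_mform fun_upd_idem)

lemma norm_le_if_inner_le:
  fixes a :: "'a::real_inner"
  assumes "C \<ge> 0" and "\<And>v. norm v = 1 \<Longrightarrow> \<bar>a \<bullet> v\<bar> \<le> C"
  shows "norm a \<le> C"
proof (cases "a = 0")
  case False
  then have "\<bar>a \<bullet> (a /\<^sub>R norm a)\<bar> \<le> C" by (intro assms) simp
  then show ?thesis using False by (simp add: power2_norm_eq_inner[symmetric] power2_eq_square flip: mult.assoc)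
qed (use assms in simp)

text \<open>Every summand of the derivative in a unit direction is the tensor evaluated at unit
  vectors, hence at most the Weyl norm.\<close>

lemma norm_form_gradient_le:
  assumes "homogeneous_form f" "norm x = 1"
  shows "norm (form_gradient f x) \<le> real (fst f) * form_norm f"
proof (rule norm_le_if_inner_le)
  fix v :: "real ^ 'a" assume v: "norm v = 1"
  have "\<bar>form_gradient f x \<bullet> v\<bar> \<le>
      (\<Sum>j<fst f. \<bar>mform (form_tensor f) (fst f) ((\<lambda>_. x)(j := v))\<bar>)"
    unfolding inner_form_gradient[OF assms(1)] frechet_derivative_feval[OF assms(1)]
    by (rule sum_abs)
  also have "\<dots> \<le> (\<Sum>j<fst f. form_norm f * 1)"
  proof (rule sum_mono)
    fix j
    have "(\<Prod>k<fst f. norm (((\<lambda>_. x)(j := v)) k)) = 1"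
      using v assms(2) by (intro prod.neutral) auto
    then show "\<bar>mform (form_tensor f) (fst f) ((\<lambda>_. x)(j := v))\<bar> \<le> form_norm f * 1"
      using abs_mform_le[of "form_tensor f" "fst f" "(\<lambda>_. x)(j := v)"] unfolding form_norm_eq by simp
  qed
  finally show "\<bar>form_gradient f x \<bullet> v\<bar> \<le> real (fst f) * form_norm f" by simp
qed simp

lemma form_gradient_diff_le:
  assumes "homogeneous_form f" "norm x = 1" "norm y = 1"
  shows "norm (form_gradient f x - form_gradient f y) \<le>
    real (fst f) * real (fst f) * form_norm f * norm (x - y)"
proof (rule norm_le_if_inner_le)
  let ?X = "\<lambda>v j. (\<lambda>_. x)(j := v)" and ?Y = "\<lambda>v j. (\<lambda>_. y)(j := v)"
  fix v :: "real ^ 'a" assume v: "norm v = 1"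
  have "(form_gradient f x - form_gradient f y) \<bullet> v =
      (\<Sum>j<fst f. mform (form_tensor f) (fst f) (?X v j) - mform (form_tensor f) (fst f) (?Y v j))"
    unfolding inner_diff_left inner_form_gradient[OF assms(1)] frechet_derivative_feval[OF assms(1)]
    by (rule sum_subtractf[symmetric])
  also have "\<bar>\<dots>\<bar> \<le> (\<Sum>j<fst f.
      \<bar>mform (form_tensor f) (fst f) (?X v j) - mform (form_tensor f) (fst f) (?Y v j)\<bar>)"
    by (rule sum_abs)
  also have "\<dots> \<le> (\<Sum>j<fst f. form_norm f * (real (fst f) * norm (x - y)))"
  proof (rule sum_mono)
    fix j
    have "\<bar>mform (form_tensor f) (fst f) (?X v j) - mform (form_tensor f) (fst f) (?Y v j)\<bar> \<le>
        form_norm f * (\<Sum>k<fst f. norm (?X v j k - ?Y v j k))"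
      unfolding form_norm_eq by (rule mform_diff_le) (use v assms in auto)
    \<comment> \<open>Position \<open>j\<close> holds \<open>v\<close> on both sides and contributes
      0; bounding it like the others gives the simpler factor \<open>d\<close> in place of
      \<open>d - 1\<close>.\<close>
    also have "\<dots> \<le> form_norm f * (\<Sum>k<fst f. norm (x - y))"
      by (intro mult_left_mono sum_mono) auto
    finally show "\<bar>mform (form_tensor f) (fst f) (?X v j) - mform (form_tensor f) (fst f) (?Y v j)\<bar>
        \<le> form_norm f * (real (fst f) * norm (x - y))" by simp
  qed
  finally show "\<bar>(form_gradient f x - form_gradient f y) \<bullet> v\<bar> \<le>
      real (fst f) * real (fst f) * form_norm f * norm (x - y)"
    by (simp add: mult_ac)
qed simp

section \<open>Weighted combinations of the gradients of a system\<close>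

text \<open>The adjoint of the derivative scaled by \<Delta> inverse, applied to \<open>z\<close>.
  In the surjective case the matrix in \<open>mu_proj\<close> is a right inverse of this scaled
  derivative on the tangent space.\<close>

definition weighted_gradient :: "'n::finite system \<Rightarrow> real ^ 'n \<Rightarrow> (nat \<Rightarrow> real) \<Rightarrow> real ^ 'n" where
  "weighted_gradient M x z =
     (\<Sum>j<length M. (z j / sqrt (real (fst (M ! j)))) *\<^sub>R form_gradient (M ! j) x)"

text \<open>For a unit vector \<open>x\<close>, the orthogonal projection onto the tangent space at
  \<open>x\<close>.\<close>

definition tangent_part :: "real ^ 'n::finite \<Rightarrow> real ^ 'n \<Rightarrow> real ^ 'n" where
  "tangent_part x w = w - (w \<bullet> x) *\<^sub>R x"

lemma norm_tangent_part_le: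
  assumes "norm x = 1"
  shows "norm (tangent_part x w) \<le> norm w"
proof -
  have "x \<bullet> x = 1" using assms by (simp add: norm_eq_1)
  then have "(norm (tangent_part x w))\<^sup>2 = (norm w)\<^sup>2 - (w \<bullet> x)\<^sup>2"
    unfolding tangent_part_def power2_norm_eq_inner
    by (simp add: inner_diff_left inner_diff_right inner_commute power2_eq_square)
  then have "(norm (tangent_part x w))\<^sup>2 \<le> (norm w)\<^sup>2" by simp
  then show ?thesis by (rule power2_le_imp_le) simp
qed

lemma system_norm_eq: "system_norm M = L2_set (\<lambda>j. form_norm (M ! j)) {..<length M}"
proof -
  have "weyl_inner (fst f) (snd f) (snd f) = (form_norm f)\<^sup>2" for f :: "'a form"
    by (simp add: form_norm_def weyl_inner_eq_sum_words sum_nonneg)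
  then show ?thesis by (simp add: system_norm_def system_inner_def L2_set_def)
qed

lemma system_norm_nonneg [simp]: "system_norm M \<ge> 0"
  by (simp add: system_norm_eq L2_set_nonneg)

text \<open>Cauchy-Schwarz over the members of a system: with \<open>b\<close> the member norms or
  the member values, bounds for single forms become bounds by \<open>system_norm\<close> or
  \<open>value_norm\<close>.\<close>

lemma norm_sum_scaled_le:
  fixes w :: "nat \<Rightarrow> 'a::real_normed_vector"
  assumes "C \<ge> 0" and "\<And>j. j < m \<Longrightarrow> norm (w j) \<le> C * \<bar>b j\<bar>"
  shows "norm (\<Sum>j<m. z j *\<^sub>R w j) \<le> C * L2_set z {..<m} * L2_set b {..<m}"
proof -
  have "norm (\<Sum>j<m. z j *\<^sub>R w j) \<le> (\<Sum>j<m. \<bar>z j\<bar> * (C * \<bar>b j\<bar>))"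
    by (rule order_trans[OF norm_sum sum_mono]) (auto intro!: mult_left_mono assms)
  also have "\<dots> = C * (\<Sum>j<m. \<bar>z j\<bar> * \<bar>b j\<bar>)"
    by (simp add: sum_distrib_left mult_ac)
  also have "\<dots> \<le> C * (L2_set z {..<m} * L2_set b {..<m})"
    by (intro mult_left_mono L2_set_mult_ineq assms)
  finally show ?thesis by (simp add: mult_ac)
qed

text \<open>\<open>D\<close> is any bound on the degrees rather than their maximum, so that all
  subsystems of one system can share the same \<open>D\<close>.\<close>

locale normalised_system =
  fixes M :: "'n::finite system" and D :: real
  assumes hom: "\<And>j. j < length M \<Longrightarrow> homogeneous_form (M ! j)"
    and deg: "\<And>j. j < length M \<Longrightarrow> real (fst (M ! j)) \<le> D"
    and D_ge_1: "D \<ge> 1"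
begin

lemma weighted_gradient_eq:
  "weighted_gradient M x z =
    (\<Sum>j<length M. z j *\<^sub>R ((1 / sqrt (real (fst (M ! j)))) *\<^sub>R form_gradient (M ! j) x))"
  by (simp add: weighted_gradient_def)

lemma div_sqrt_mult_self: "(1 / sqrt (real d)) * real d = sqrt (real d)"
  by (simp add: real_div_sqrt)

lemma norm_weighted_gradient_le:
  assumes "norm x = 1"
  shows "norm (weighted_gradient M x z) \<le> sqrt D * L2_set z {..<length M} * system_norm M"
  unfolding weighted_gradient_eq system_norm_eq
proof (rule norm_sum_scaled_le)
  fix j assume j: "j < length M"
  let ?d = "real (fst (M ! j))"
  have "norm ((1 / sqrt ?d) *\<^sub>R form_gradient (M ! j) x) \<le> (1 / sqrt ?d) * (?d * form_norm (M ! j))"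
    using norm_form_gradient_le[OF hom[OF j] assms] by (simp add: divide_right_mono)
  also have "\<dots> = sqrt ?d * form_norm (M ! j)"
    using div_sqrt_mult_self[of "fst (M ! j)"] by (simp only: mult.assoc[symmetric])
  also have "\<dots> \<le> sqrt D * \<bar>form_norm (M ! j)\<bar>"
    using deg[OF j] by (simp add: mult_right_mono)
  finally show "norm ((1 / sqrt ?d) *\<^sub>R form_gradient (M ! j) x) \<le> sqrt D * \<bar>form_norm (M ! j)\<bar>" .
qed (use D_ge_1 in simp)

text \<open>The gradient of a form of degree \<open>d\<close> has Lipschitz constant
  \<open>d * d\<close> times the Weyl norm; the weight \<open>1 / sqrt d\<close> leaves
  \<open>d * sqrt d\<close>. This is where the power 3/2 of the degree arises.\<close>

lemma weighted_gradient_diff_le: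
  assumes "norm x = 1" "norm y = 1"
  shows "norm (weighted_gradient M x z - weighted_gradient M y z) \<le>
    D * sqrt D * norm (x - y) * L2_set z {..<length M} * system_norm M"
proof -
  have "weighted_gradient M x z - weighted_gradient M y z = (\<Sum>j<length M. z j *\<^sub>R
      ((1 / sqrt (real (fst (M ! j)))) *\<^sub>R (form_gradient (M ! j) x - form_gradient (M ! j) y)))"
    unfolding weighted_gradient_eq by (simp add: sum_subtractf[symmetric] algebra_simps)
  also have "norm \<dots> \<le> (D * sqrt D * norm (x - y)) * L2_set z {..<length M} * system_norm M"
    unfolding system_norm_eq
  proof (rule norm_sum_scaled_le)
    fix j assume j: "j < length M"
    let ?d = "real (fst (M ! j))"
    let ?g = "form_gradient (M ! j) x - form_gradient (M ! j) y"
    have "norm ((1 / sqrt ?d) *\<^sub>R ?g) \<le>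
        (1 / sqrt ?d) * (?d * ?d * form_norm (M ! j) * norm (x - y))"
      using form_gradient_diff_le[OF hom[OF j] assms] by (simp add: divide_right_mono)
    also have "\<dots> = (1 / sqrt ?d * ?d) * (?d * form_norm (M ! j) * norm (x - y))"
      by (simp only: mult_ac)
    also have "\<dots> = ?d * sqrt ?d * form_norm (M ! j) * norm (x - y)"
      unfolding div_sqrt_mult_self by (simp only: mult_ac)
    also have "\<dots> \<le> D * sqrt D * form_norm (M ! j) * norm (x - y)"
      using deg[OF j] D_ge_1 by (intro mult_right_mono mult_mono) auto
    finally show "norm ((1 / sqrt ?d) *\<^sub>R ?g) \<le> D * sqrt D * norm (x - y) * \<bar>form_norm (M ! j)\<bar>"
      by (simp add: mult_ac)
  qed (use D_ge_1 in simp)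
  finally show ?thesis .
qed

text \<open>By Euler's identity the radial component is a weighted sum of values, hence small
  wherever the system is small.\<close>

lemma weighted_gradient_radial:
  "\<bar>weighted_gradient M x z \<bullet> x\<bar> \<le> sqrt D * L2_set z {..<length M} * value_norm M x"
proof -
  have "weighted_gradient M x z \<bullet> x =
      (\<Sum>j<length M. z j *\<^sub>R (sqrt (real (fst (M ! j))) * feval (M ! j) x))"
    unfolding weighted_gradient_eq inner_sum_left
  proof (rule sum.cong)
    fix j assume "j \<in> {..<length M}"
    then have "(z j *\<^sub>R (1 / sqrt (real (fst (M ! j)))) *\<^sub>R form_gradient (M ! j) x) \<bullet> x =
        z j *\<^sub>R ((1 / sqrt (real (fst (M ! j))) * real (fst (M ! j))) * feval (M ! j) x)"
      by (simp add: form_gradient_self hom)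
    then show "(z j *\<^sub>R (1 / sqrt (real (fst (M ! j)))) *\<^sub>R form_gradient (M ! j) x) \<bullet> x =
        z j *\<^sub>R (sqrt (real (fst (M ! j))) * feval (M ! j) x)"
      by (simp only: div_sqrt_mult_self)
  qed simp
  then have "\<bar>weighted_gradient M x z \<bullet> x\<bar> =
      norm (\<Sum>j<length M. z j *\<^sub>R (sqrt (real (fst (M ! j))) * feval (M ! j) x))" by simp
  also have "\<dots> \<le> sqrt D * L2_set z {..<length M} * value_norm M x"
    unfolding value_norm_def
    by (rule norm_sum_scaled_le) (use deg D_ge_1 in \<open>auto simp: abs_mult intro!: mult_right_mono\<close>)
  finally show ?thesis .
qed

end

section \<open>Condition numbers and singular values\<close>

text \<open>In the surjective case the least residual is 0. Removing from any exact solution its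
  component in the kernel yields the vector that the definite description selects.\<close>

lemma pinv_of_surj:
  fixes V :: "'a::euclidean_space set"
  assumes V: "subspace V" and lin: "\<And>j. j < m \<Longrightarrow> linear (\<lambda>v. A v j)"
    and surj: "surj_on_coords V m A"
  shows "pinv V m A y \<in> V" and "\<And>j. j < m \<Longrightarrow> A (pinv V m A y) j = y j"
proof -
  note A_lin = linear_0[OF lin] linear_add[OF lin] linear_diff[OF lin] linear_scale[OF lin]
  define N where "N = {w \<in> V. \<forall>j<m. A w j = 0}"
  have N: "subspace N"
    using V unfolding N_def subspace_def by (auto simp: A_lin)
  obtain v0 where v0: "v0 \<in> V" "\<And>j. j < m \<Longrightarrow> A v0 j = y j"
    using surj unfolding surj_on_coords_def by blast
  obtain n p where np: "n \<in> span N" "\<And>w. w \<in> span N \<Longrightarrow> orthogonal p w" "v0 = n + p"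
    using orthogonal_subspace_decomp_exists[of N v0] by metis
  have nN: "n \<in> N" using np(1) N by (simp add: span_eq_iff[THEN iffD2])
  have p: "p = v0 - n" using np(3) by simp
  define P where "P v \<longleftrightarrow> v \<in> V \<and> (\<forall>w\<in>V. (\<forall>j<m. A w j = 0) \<longrightarrow> v \<bullet> w = 0)
     \<and> (\<forall>w\<in>V. L2_set (\<lambda>j. A v j - y j) {..<m} \<le> L2_set (\<lambda>j. A w j - y j) {..<m})" for v
  have pV: "p \<in> V" using nN v0(1) V by (auto simp: p N_def subspace_diff)
  have Ap: "A p j = y j" if "j < m" for j
    using nN v0(2)[OF that] that by (auto simp: p N_def A_lin)
  have "P p"
  proof -
    have "L2_set (\<lambda>j. A p j - y j) {..<m} = 0"
      using Ap by (simp add: L2_set_eq_0_iff)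
    moreover have "p \<bullet> w = 0" if "w \<in> V" "\<forall>j<m. A w j = 0" for w
    proof -
      have "w \<in> span N" by (rule span_base) (use that in \<open>simp add: N_def\<close>)
      then show ?thesis using np(2) by (simp add: orthogonal_def)
    qed
    ultimately show ?thesis using pV by (simp add: P_def L2_set_nonneg)
  qed
  \<comment> \<open>Two candidates differ by a kernel vector to which both are orthogonal, so the
    difference is orthogonal to itself.\<close>
  moreover have "v = p" if "P v" for v
  proof -
    have "L2_set (\<lambda>j. A v j - y j) {..<m} \<le> L2_set (\<lambda>j. A p j - y j) {..<m}"
      using that pV unfolding P_def by blast
    also have "\<dots> = 0" using Ap by (simp add: L2_set_eq_0_iff)
    finally have "L2_set (\<lambda>j. A v j - y j) {..<m} = 0"
      using L2_set_nonneg by (metis order_antisym)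
    then have "A v j = y j" if "j < m" for j
      using that by (simp add: L2_set_eq_0_iff)
    then have *: "v - p \<in> V" "\<forall>j<m. A (v - p) j = 0"
      using \<open>P v\<close> pV V Ap by (auto simp: P_def subspace_diff A_lin)
    then have "v \<bullet> (v - p) = 0" "p \<bullet> (v - p) = 0"
      using \<open>P v\<close> \<open>P p\<close> unfolding P_def by blast+
    then have "(v - p) \<bullet> (v - p) = 0" by (simp add: inner_diff_left)
    then show ?thesis by simp
  qed
  ultimately have "pinv V m A y = p"
    unfolding pinv_def P_def[symmetric] by (rule the_equality)
  then show "pinv V m A y \<in> V" "\<And>j. j < m \<Longrightarrow> A (pinv V m A y) j = y j"
    using pV Ap by auto
qed

lemma subspace_tangent_space: "subspace (tangent_space x)"
  by (auto simp: subspace_def tangent_space_def inner_add_right)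

lemma inv_sqrt_antimono:
  assumes "0 \<le> s" "s \<le> t"
  shows "inv_sqrt t \<le> inv_sqrt s"
  using assms by (cases s; cases t) (auto simp: inv_sqrt_def frac_le zero_ereal_def)

lemma inv_sqrt_ereal: "s > 0 \<Longrightarrow> inv_sqrt (ereal s) = ereal (1 / sqrt s)"
  by (simp add: inv_sqrt_def zero_ereal_def)

lemma mu_proj_nonneg: "mu_proj M x \<ge> 0"
proof -
  have "ereal (norm (pinv V m A (\<lambda>j. b j * (0::real)))) \<le>
      (SUP y\<in>{y. L2_set y {..<m} \<le> 1}. ereal (norm (pinv V m A (\<lambda>j. b j * y j))))" for V :: "(real^'a) set" and m A b
    \<comment> \<open>The vector 0 lies in the unit ball, so the supremum is not taken over the
      empty set, where it would be -\<infinity>.\<close>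
    by (rule SUP_upper2[of "\<lambda>_. 0"]) (auto simp: L2_set_def)
  then have "0 \<le> (SUP y\<in>{y. L2_set y {..<m} \<le> 1}. ereal (norm (pinv V m A (\<lambda>j. b j * y j))))" for V :: "(real^'a) set" and m A b
    by (rule order_trans[rotated]) simp
  then show ?thesis by (auto simp: mu_proj_def Let_def)
qed

context normalised_system
begin

lemma system_deriv_eq: "j < length M \<Longrightarrow> system_deriv M x v j = form_gradient (M ! j) x \<bullet> v"
  by (simp add: system_deriv_def inner_form_gradient hom)

text \<open>A form of degree 0 has zero gradient, so its coordinate of the derivative cannot reach
  1. Thus the divisions by \<open>sqrt d\<close> are genuine once the derivative is
  surjective.\<close>

lemma surj_imp_degree_pos:
  assumes "norm x = 1" "surj_on_coords V (length M) (system_deriv M x)" "j < length M"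
  shows "fst (M ! j) > 0"
proof (rule ccontr)
  assume "\<not> fst (M ! j) > 0"
  then have "form_gradient (M ! j) x = 0"
    using norm_form_gradient_le[OF hom[OF assms(3)] assms(1)] by simp
  moreover have "\<exists>v\<in>V. \<forall>j<length M. system_deriv M x v j = 1"
    using assms(2)[unfolded surj_on_coords_def, rule_format, of "\<lambda>_. 1"] .
  then obtain v where "system_deriv M x v j = 1" using assms(3) by blast
  ultimately show False using assms(3) by (simp add: system_deriv_eq)
qed

text \<open>The pseudoinverse is applied to \<open>z\<close> scaled to unit length, where the
  supremum in \<open>mu_proj\<close> bounds it, and the solution is scaled back;
  \<open>z = 0\<close> has the solution 0.\<close>

lemma mu_proj_solution:
  assumes surj: "surj_on_coords (tangent_space x) (length M) (system_deriv M x)"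
    and mu: "mu_proj M x \<le> ereal K"
  obtains v where "x \<bullet> v = 0"
    "\<And>j. j < length M \<Longrightarrow> form_gradient (M ! j) x \<bullet> v = sqrt (real (fst (M ! j))) * z j"
    "system_norm M * norm v \<le> K * L2_set z {..<length M}"
proof (cases "L2_set z {..<length M} = 0")
  case True
  then have "z j = 0" if "j < length M" for j
    using that by (simp add: L2_set_eq_0_iff)
  then show ?thesis using that[of 0] True by simp
next
  case False
  define s where "s = L2_set z {..<length M}"
  have s: "s > 0" using False by (simp add: s_def order_less_le L2_set_nonneg)
  define y where "y j = z j / s" for j
  define u where "u = pinv (tangent_space x) (length M) (system_deriv M x)
    (\<lambda>j. sqrt (real (fst (M ! j))) * y j)"
  have "L2_set y {..<length M} = (1 / s) * s"
    unfolding y_def using L2_set_right_distrib[of "1 / s" z "{..<length M}"] s by (simp add: s_def)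
  then have y: "L2_set y {..<length M} \<le> 1" using s by simp
  have lin: "linear (\<lambda>v. system_deriv M x v j)" if "j < length M" for j
    unfolding system_deriv_eq[OF that] by (rule bounded_linear.linear[OF bounded_linear_inner_right])
  note uu = pinv_of_surj[where y = "\<lambda>j. sqrt (real (fst (M ! j))) * y j",
    OF subspace_tangent_space lin surj, folded u_def]
  have "ereal (system_norm M) * ereal (norm u) \<le> mu_proj M x"
    unfolding mu_proj_def Let_def u_def if_P[OF surj]
    by (rule ereal_mult_left_mono, rule SUP_upper2[of y]) (use y in auto)
  from order_trans[OF this mu] have K: "system_norm M * norm u \<le> K" by simp
  show ?thesis
  proof (rule that[of "s *\<^sub>R u"])
    show "x \<bullet> (s *\<^sub>R u) = 0" using uu(1) by (simp add: tangent_space_def)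
    show "form_gradient (M ! j) x \<bullet> (s *\<^sub>R u) = sqrt (real (fst (M ! j))) * z j"
      if "j < length M" for j
      using uu(2)[of j] that s by (simp add: system_deriv_eq y_def)
    show "system_norm M * norm (s *\<^sub>R u) \<le> K * L2_set z {..<length M}"
      using K s by (simp add: s_def[symmetric] mult.left_commute mult_right_mono)
  qed
qed

text \<open>The least singular value of the scaled derivative, read off from its adjoint.\<close>

lemma weighted_gradient_lower:
  assumes x: "norm x = 1"
    and surj: "surj_on_coords (tangent_space x) (length M) (system_deriv M x)"
    and mu: "mu_proj M x \<le> ereal K"
  shows "system_norm M * L2_set z {..<length M} \<le>
    K * norm (tangent_part x (weighted_gradient M x z))"
proof -
  define s where "s = L2_set z {..<length M}"
  define w where "w = weighted_gradient M x z"
  obtain v where v: "x \<bullet> v = 0"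
    "\<And>j. j < length M \<Longrightarrow> form_gradient (M ! j) x \<bullet> v = sqrt (real (fst (M ! j))) * z j"
    "system_norm M * norm v \<le> K * s"
    using mu_proj_solution[OF surj mu] unfolding s_def by blast
  \<comment> \<open>The weights \<open>1 / sqrt d\<close> cancel the factors \<open>sqrt d\<close>
    prescribed for \<open>v\<close>, so the pairing gives the squared length of
    \<open>z\<close>.\<close>
  have "w \<bullet> v = (\<Sum>j<length M. (z j)\<^sup>2)"
    unfolding w_def weighted_gradient_def inner_sum_left
  proof (rule sum.cong)
    fix j assume "j \<in> {..<length M}"
    then show "(z j / sqrt (real (fst (M ! j)))) *\<^sub>R form_gradient (M ! j) x \<bullet> v = (z j)\<^sup>2"
      using v(2)[of j] surj_imp_degree_pos[OF x surj, of j] by (simp add: power2_eq_square)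
  qed simp
  also have "\<dots> = s\<^sup>2" by (simp add: s_def L2_set_def sum_nonneg)
  finally have "s\<^sup>2 = tangent_part x w \<bullet> v"
    using v(1) by (simp add: tangent_part_def inner_diff_left)
  also have "\<dots> \<le> norm (tangent_part x w) * norm v" by (rule norm_cauchy_schwarz)
  finally have "system_norm M * s\<^sup>2 \<le> system_norm M * (norm (tangent_part x w) * norm v)"
    by (intro mult_left_mono) auto
  also have "\<dots> \<le> norm (tangent_part x w) * (K * s)"
    using mult_left_mono[OF v(3), of "norm (tangent_part x w)"] by (simp add: mult_ac)
  finally have "(system_norm M * s) * s \<le> (K * norm (tangent_part x w)) * s"
    by (simp add: power2_eq_square mult_ac)
  \<comment> \<open>A factor \<open>s\<close> is cancelled if it is positive; for
    \<open>s = 0\<close> the claim is that the right-hand side is nonnegative.\<close>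
  moreover have "s > 0 \<or> s = 0" by (auto simp: s_def order_less_le L2_set_nonneg)
  moreover have "K \<ge> 0" using order_trans[OF mu_proj_nonneg mu] by simp
  ultimately have "system_norm M * s \<le> K * norm (tangent_part x w)"
    by (auto dest: mult_right_le_imp_le)
  then show ?thesis by (simp add: s_def w_def)
qed

section \<open>Lower bounds for the condition number and control of \<open>mu_proj\<close> by
  it\<close>

lemma value_norm_le_system_norm:
  assumes "norm x = 1"
  shows "value_norm M x \<le> system_norm M"
proof -
  have "L2_set (\<lambda>j. \<bar>feval (M ! j) x\<bar>) {..<length M} \<le> system_norm M"
    unfolding system_norm_eq by (rule L2_set_mono) (auto intro: abs_feval_le[OF hom assms])
  then show ?thesis by (simp add: value_norm_def L2_set_def)
qed

text \<open>Testing the singular value bound on the first coordinate vector: its weighted gradient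
  has norm at most \<open>sqrt D * system_norm M\<close>. A derivative that is not surjective gives
  the inverse 0.\<close>

lemma inverse_mu_proj_le:
  assumes x: "norm x = 1" and M: "M \<noteq> []" "system_norm M > 0"
  shows "inverse (mu_proj M x) \<le> ereal (sqrt D)"
proof (cases "mu_proj M x = \<infinity>")
  case True
  then show ?thesis using D_ge_1 by simp
next
  case False
  then have surj: "surj_on_coords (tangent_space x) (length M) (system_deriv M x)"
    by (auto simp: mu_proj_def Let_def split: if_splits)
  obtain K where K: "mu_proj M x = ereal K" "K \<ge> 0"
    using False mu_proj_nonneg[of M x] by (cases "mu_proj M x") auto
  define z :: "nat \<Rightarrow> real" where "z j = (if j = 0 then 1 else 0)" for j
  have "(\<Sum>j<length M. (z j)\<^sup>2) = 1"
    using M(1) by (simp add: z_def if_distrib[of "\<lambda>t. t\<^sup>2"] cong: if_cong)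
  then have z: "L2_set z {..<length M} = 1" by (simp add: L2_set_def)
  have "system_norm M * 1 \<le> K * norm (tangent_part x (weighted_gradient M x z))"
    using weighted_gradient_lower[OF x surj, of K z] K z by simp
  also have "\<dots> \<le> K * (sqrt D * 1 * system_norm M)"
    using norm_weighted_gradient_le[OF x, of z] norm_tangent_part_le[OF x, of "weighted_gradient M x z"] z K(2)
    by (intro mult_left_mono) auto
  finally have "system_norm M * 1 \<le> system_norm M * (K * sqrt D)" by (simp add: mult_ac)
  then have 1: "1 \<le> K * sqrt D" using M(2) by (simp only: mult_le_cancel_left_pos)
  then have "K > 0" using K(2) by (cases "K = 0") auto
  then show ?thesis using K 1 by (simp add: field_simps)
qed

text \<open>Under the inverse square root, the term from \<open>mu_proj\<close> is at most
  \<open>D\<close> and the value term at most 1.\<close>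

lemma kappa_at_ge:
  assumes x: "norm x = 1" and M: "M \<noteq> []" "system_norm M > 0"
  shows "ereal (1 / sqrt (D + 1)) \<le> kappa_at M x"
proof (cases "\<forall>f\<in>set M. snd f = 0")
  case False
  have i0: "0 \<le> inverse (mu_proj M x)" using mu_proj_nonneg[of M x]
    by (cases "mu_proj M x") auto
  have 1: "(inverse (mu_proj M x))\<^sup>2 \<le> ereal D"
  proof -
    have "(inverse (mu_proj M x))\<^sup>2 \<le> (ereal (sqrt D))\<^sup>2"
      unfolding power2_eq_square using inverse_mu_proj_le[OF assms] i0 D_ge_1 by (intro ereal_mult_mono) auto
    then show ?thesis using D_ge_1 by (simp add: power2_eq_square)
  qed
  have "(value_norm M x)\<^sup>2 / (system_norm M)\<^sup>2 \<le> 1"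
    using value_norm_le_system_norm[OF x] M(2)
    by (simp add: divide_le_eq_1 power_mono value_norm_def L2_set_nonneg)
  then have "(inverse (mu_proj M x))\<^sup>2 + ereal ((value_norm M x)\<^sup>2 / (system_norm M)\<^sup>2)
      \<le> ereal D + ereal 1"
    using 1 by (intro add_mono) auto
  moreover have "0 \<le> (inverse (mu_proj M x))\<^sup>2 + ereal ((value_norm M x)\<^sup>2 / (system_norm M)\<^sup>2)"
    using i0 by (intro add_nonneg_nonneg) (auto simp: power2_eq_square)
  ultimately have "inv_sqrt (ereal (D + 1)) \<le> kappa_at M x"
    unfolding kappa_at_def using False by (simp only: if_False simp_thms plus_ereal.simps inv_sqrt_antimono)
  then show ?thesis using D_ge_1 by (simp add: inv_sqrt_ereal)
next
  case True
  with M(1) have "kappa_at M x = \<infinity>" unfolding kappa_at_def by (intro if_P conjI)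
  then show ?thesis by simp
qed

text \<open>The two terms in \<open>kappa_at\<close> sum to at least \<open>1 / k\<^sup>2\<close>,
  and the value term is at most \<open>1 / (16 * k\<^sup>2)\<close>. So \<open>mu_proj\<close> is at
  most \<open>4 / sqrt 15 * k\<close>, which is rounded up to \<open>10/9 * k\<close>.\<close>

lemma mu_proj_le_of_kappa_at:
  assumes M: "M \<noteq> []" "system_norm M > 0"
    and k: "k > 0" "kappa_at M x \<le> ereal k"
    and v: "4 * k * value_norm M x \<le> system_norm M"
  shows "surj_on_coords (tangent_space x) (length M) (system_deriv M x)"
    and "mu_proj M x \<le> ereal (10/9 * k)"
proof -
  define t where "t = (value_norm M x)\<^sup>2 / (system_norm M)\<^sup>2"
  have v0: "value_norm M x \<ge> 0" by (simp add: value_norm_def L2_set_nonneg)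
  have t: "16 * k\<^sup>2 * t \<le> 1"
  proof -
    have "(4 * k * value_norm M x)\<^sup>2 \<le> (system_norm M)\<^sup>2"
      using v v0 k by (intro power_mono) auto
    then show ?thesis using M(2) by (simp add: t_def power_mult_distrib)
  qed
  have nz: "\<not> (\<forall>f\<in>set M. snd f = 0)"
  proof
    assume "\<forall>f\<in>set M. snd f = 0"
    with M(1) have "kappa_at M x = \<infinity>" unfolding kappa_at_def by (intro if_P conjI)
    with k(2) show False by simp
  qed
  then have le: "inv_sqrt ((inverse (mu_proj M x))\<^sup>2 + ereal t) \<le> ereal k"
    using k(2) unfolding kappa_at_def t_def by (simp only: if_False simp_thms)
  have t0: "t \<ge> 0" by (simp add: t_def)
  have mu: "mu_proj M x = ereal K \<and> K \<ge> 0 \<and> 9/10 * K \<le> k" if "mu_proj M x \<noteq> \<infinity>"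
      "K = real_of_ereal (mu_proj M x)" for K
  proof -
    have K: "mu_proj M x = ereal K" "K \<ge> 0"
      using that mu_proj_nonneg[of M x] by (cases "mu_proj M x"; simp)+
    have "9/10 * K \<le> k" if K0: "K > 0"
    proof -
      have pos: "1 / K\<^sup>2 + t > 0" using K0 t0 by (simp add: add_pos_nonneg)
      have "(inverse (mu_proj M x))\<^sup>2 + ereal t = ereal (1 / K\<^sup>2 + t)"
        using K K0 by (simp add: ereal_power power_one_over inverse_eq_divide)
      then have "1 / sqrt (1 / K\<^sup>2 + t) \<le> k"
        using le pos by (simp add: inv_sqrt_ereal)
      then have "1 \<le> k * sqrt (1 / K\<^sup>2 + t)" using pos by (simp add: divide_le_eq)
      then have "1\<^sup>2 \<le> (k * sqrt (1 / K\<^sup>2 + t))\<^sup>2" by (intro power_mono) auto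
      then have "1 \<le> k\<^sup>2 * (1 / K\<^sup>2 + t)" using pos by (simp add: power_mult_distrib)
      then have "1 \<le> k\<^sup>2 / K\<^sup>2 + k\<^sup>2 * t" by (simp add: distrib_left)
      then have "15 / 16 \<le> k\<^sup>2 / K\<^sup>2" using t by linarith
      then have "15 * K\<^sup>2 \<le> 16 * k\<^sup>2" using K0 by (simp add: field_simps)
      moreover have "(9/10 * K)\<^sup>2 = 81/100 * K\<^sup>2" by (simp add: power2_eq_square)
      ultimately have "(9/10 * K)\<^sup>2 \<le> k\<^sup>2" using zero_le_power2[of K] by linarith
      from power2_le_imp_le[OF this] show ?thesis using k(1) by simp
    qed
    then show ?thesis using K k(1) by (cases "K = 0") auto
  qed
  \<comment> \<open>Were it infinite, the value term alone would have to reach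
    \<open>1 / k\<^sup>2\<close>.\<close>
  have fin: "mu_proj M x \<noteq> \<infinity>"
  proof
    assume "mu_proj M x = \<infinity>"
    then have le': "inv_sqrt (ereal t) \<le> ereal k" using le by (simp add: ereal_power power2_eq_square)
    have tp: "t > 0" using le' t0 by (cases "t = 0") (auto simp: inv_sqrt_def zero_ereal_def)
    then have "1 / sqrt t \<le> k" using le' by (simp add: inv_sqrt_ereal)
    then have "1 \<le> k * sqrt t" using tp by (simp add: divide_le_eq)
    then have "1\<^sup>2 \<le> (k * sqrt t)\<^sup>2" by (intro power_mono) auto
    then have "1 \<le> k\<^sup>2 * t" using tp by (simp add: power_mult_distrib)
    then show False using t by simp
  qed
  then show "surj_on_coords (tangent_space x) (length M) (system_deriv M x)"
    by (auto simp: mu_proj_def Let_def split: if_splits)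
  obtain K where "mu_proj M x = ereal K" "9/10 * K \<le> k" using mu[OF fin refl] by blast
  then show "mu_proj M x \<le> ereal (10/9 * k)" by simp
qed

end

section \<open>Error bounds on the sphere\<close>

text \<open>With \<open>h = s / 2\<close>, the double angle formula and \<open>h \<le> tan h\<close>
  give \<open>sin s \<ge> 2 * h * (cos h)\<^sup>2\<close>, and
  \<open>(cos h)\<^sup>2 \<ge> 1 / 2\<close> up to \<open>pi / 4\<close>.\<close>

lemma sin_ge_half:
  assumes "0 \<le> s" "s \<le> pi / 2"
  shows "s / 2 \<le> sin s"
proof -
  define h where "h = s / 2"
  have h: "0 \<le> h" "h \<le> pi / 4" using assms by (auto simp: h_def)
  have c: "cos h \<ge> cos (pi / 4)" using h by (intro cos_monotone_0_pi_le) auto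
  then have c0: "cos h > 0" by (rule less_le_trans[rotated]) (simp add: cos_45)
  have "(cos (pi / 4))\<^sup>2 \<le> (cos h)\<^sup>2" using c by (intro power_mono) (auto simp: cos_45)
  then have c2: "1 / 2 \<le> (cos h)\<^sup>2" by (simp add: cos_45 power_divide)
  have "h < pi / 2" using h pi_gt_zero by linarith
  then have "h \<le> \<bar>tan h\<bar>" using abs_tan_ge[of h] h by simp
  moreover have "sin h \<ge> 0" using h by (intro sin_ge_zero) auto
  ultimately have "h * cos h \<le> sin h"
    using c0 by (simp add: tan_def abs_if field_simps split: if_splits)
  then have "2 * (h * cos h) * cos h \<le> 2 * sin h * cos h" using c0 by simp
  also have "\<dots> = sin s" using sin_double[of h] by (simp add: h_def)
  finally have "2 * h * (cos h)\<^sup>2 \<le> sin s" by (simp add: power2_eq_square mult_ac)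
  moreover have "2 * h * (1 / 2) \<le> 2 * h * (cos h)\<^sup>2" using c2 h by (intro mult_left_mono) auto
  ultimately show ?thesis by (simp add: h_def)
qed

text \<open>The chord over an arc of length \<open>t\<close> is \<open>2 * sin (t / 2)\<close>,
  which is at least \<open>t / 2\<close>.\<close>

lemma sphere_dist_le:
  fixes x y :: "real ^ 'n::finite"
  assumes "norm x = 1" "norm y = 1"
  shows "sphere_dist x y \<le> 2 * norm (x - y)"
proof -
  define t where "t = sphere_dist x y"
  have b: "\<bar>x \<bullet> y\<bar> \<le> 1" using Cauchy_Schwarz_ineq2[of x y] assms by simp
  then have t: "0 \<le> t" "t \<le> pi" "cos t = x \<bullet> y"
    by (auto simp: t_def sphere_dist_def intro!: arccos_lbound arccos_ubound cos_arccos)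
  have "x \<bullet> x = 1" "y \<bullet> y = 1" using assms by (simp_all add: norm_eq_1)
  then have "(norm (x - y))\<^sup>2 = 2 - 2 * cos t"
    unfolding power2_norm_eq_inner using t(3)
    by (simp add: inner_diff_left inner_diff_right inner_commute)
  also have "\<dots> = (2 * sin (t / 2))\<^sup>2"
    using cos_double_sin[of "t / 2"] by (simp add: power_mult_distrib)
  finally have "norm (x - y) = 2 * sin (t / 2)"
    by (rule power2_eq_imp_eq) (use t in \<open>auto intro!: sin_ge_zero\<close>)
  then show ?thesis using sin_ge_half[of "t / 2"] t by (simp add: t_def)
qed

lemma great_circle:
  fixes y u :: "'a::real_inner"
  assumes "norm y = 1" "norm u = 1" "u \<bullet> y = 0"
  shows "norm (cos t *\<^sub>R y + sin t *\<^sub>R u) = 1"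
    and "dist (cos t *\<^sub>R y + sin t *\<^sub>R u) y \<le> \<bar>t\<bar>"
proof -
  have yu: "y \<bullet> y = 1" "u \<bullet> u = 1" "y \<bullet> u = 0" "u \<bullet> y = 0"
    using assms by (simp_all add: norm_eq_1 inner_commute)
  have "(cos t *\<^sub>R y + sin t *\<^sub>R u) \<bullet> (cos t *\<^sub>R y + sin t *\<^sub>R u) = (cos t)\<^sup>2 + (sin t)\<^sup>2"
    by (simp add: inner_add_left inner_add_right yu power2_eq_square)
  then show "norm (cos t *\<^sub>R y + sin t *\<^sub>R u) = 1" by (simp add: norm_eq_1)
  have "(cos t *\<^sub>R y + sin t *\<^sub>R u - y) \<bullet> (cos t *\<^sub>R y + sin t *\<^sub>R u - y) =
      (cos t)\<^sup>2 + (sin t)\<^sup>2 + 1 - 2 * cos t"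
    by (simp add: inner_add_left inner_add_right inner_diff_left inner_diff_right yu power2_eq_square algebra_simps)
  also have "\<dots> = 2 - 2 * cos t" using sin_cos_squared_add2[of t] by linarith
  also have "\<dots> = (2 * sin (t / 2))\<^sup>2"
    using cos_double_sin[of "t / 2"] by (simp add: power_mult_distrib)
  finally have "(dist (cos t *\<^sub>R y + sin t *\<^sub>R u) y)\<^sup>2 = (2 * \<bar>sin (t / 2)\<bar>)\<^sup>2"
    by (simp add: dist_norm power2_norm_eq_inner power_mult_distrib)
  then have "dist (cos t *\<^sub>R y + sin t *\<^sub>R u) y = 2 * \<bar>sin (t / 2)\<bar>"
    by (rule power2_eq_imp_eq) auto
  then show "dist (cos t *\<^sub>R y + sin t *\<^sub>R u) y \<le> \<bar>t\<bar>"
    using abs_sin_x_le_abs_x[of "t / 2"] by simp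
qed

lemma continuous_on_Max_insert_0:
  fixes h :: "'i \<Rightarrow> 'a::topological_space \<Rightarrow> real"
  assumes "finite I" "\<And>i. i \<in> I \<Longrightarrow> continuous_on S (h i)"
  shows "continuous_on S (\<lambda>y. Max (insert 0 ((\<lambda>i. h i y) ` I)))"
  using assms
proof (induction I rule: finite_induct)
  case (insert i I)
  have eq: "(\<lambda>y. Max (insert 0 ((\<lambda>i. h i y) ` insert i I))) =
      (\<lambda>y. max (h i y) (Max (insert 0 ((\<lambda>i. h i y) ` I))))"
    using insert.hyps(1) by (auto simp: insert_commute[of 0] simp del: Max_insert intro!: ext Max_insert)
  show ?case unfolding eq using insert.IH insert.prems by (intro continuous_on_max) auto
qed simp

text \<open>
  The minimiser over the compact sphere of the violation plus a multiple of the distance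
  to the given point has violation 0, since otherwise a step along a great circle would decrease
  that function (Ekeland's argument for error bounds).
\<close>

lemma sphere_error_bound:
  fixes h :: "'i \<Rightarrow> 'a::euclidean_space \<Rightarrow> real" and g :: "'i \<Rightarrow> 'a \<Rightarrow> 'a"
  assumes fin: "finite I"
    and der: "\<And>i y. i \<in> I \<Longrightarrow> (h i has_derivative (\<lambda>v. g i y \<bullet> v)) (at y)"
    and x: "norm x = 1" and c: "c > 0" and r: "r > 0"
    and hx: "\<And>i. i \<in> I \<Longrightarrow> h i x < r"
    and slope: "\<And>y e. norm y = 1 \<Longrightarrow> dist y x < c * r \<Longrightarrow> 0 < e \<Longrightarrow> e < r \<Longrightarrow>
      (\<And>i. i \<in> I \<Longrightarrow> h i y \<le> e) \<Longrightarrow> \<exists>i\<in>I. h i y = e \<Longrightarrow>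
      \<exists>u. norm u = 1 \<and> u \<bullet> y = 0 \<and> (\<forall>i\<in>I. h i y = e \<longrightarrow> g i y \<bullet> u < - (1 / c))"
  shows "\<exists>y. norm y = 1 \<and> dist y x < c * r \<and> (\<forall>i\<in>I. h i y \<le> 0)"
proof -
  \<comment> \<open>The inserted 0 makes \<phi> nonnegative, with zeros exactly where all
    constraints hold, and covers an empty \<open>I\<close>.\<close>
  define \<phi> where "\<phi> y = Max (insert 0 ((\<lambda>i. h i y) ` I))" for y
  have cont: "continuous_on S (h i)" if "i \<in> I" for i S
    by (rule continuous_at_imp_continuous_on) (use der[OF that] has_derivative_continuous in blast)
  have "continuous_on (sphere 0 1) (\<lambda>y. \<phi> y + dist y x / c)"
    unfolding \<phi>_def using fin cont c by (intro continuous_intros continuous_on_Max_insert_0) auto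
  moreover have "sphere (0 :: 'a) 1 \<noteq> {}" using x by auto
  ultimately obtain y where y: "y \<in> sphere 0 1"
      "\<And>z. z \<in> sphere 0 1 \<Longrightarrow> \<phi> y + dist y x / c \<le> \<phi> z + dist z x / c"
    using continuous_attains_inf[OF compact_sphere] by blast
  define e where "e = \<phi> y"
  have y1: "norm y = 1" using y(1) by simp
  \<comment> \<open>Comparing the minimiser with \<open>x\<close> itself bounds both its distance
    and its violation.\<close>
  have "\<phi> y + dist y x / c \<le> \<phi> x" using y(2)[of x] x by simp
  moreover have "\<phi> x < r" using fin r hx by (simp add: \<phi>_def)
  ultimately have less: "e + dist y x / c < r" by (simp add: e_def)
  have e0: "e \<ge> 0" using fin by (simp add: e_def \<phi>_def)
  have le: "h i y \<le> e" if "i \<in> I" for i using that fin by (simp add: e_def \<phi>_def)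
  have "dist y x / c < r" using less e0 by linarith
  then have d: "dist y x < c * r" using c by (simp add: field_simps)
  have "dist y x / c \<ge> 0" using c by simp
  then have er: "e < r" using less by linarith
  show ?thesis
  proof (cases "e = 0")
    case True
    then show ?thesis using le y1 d by auto
  next
    case False
    then have e: "e > 0" using e0 by simp
    have "e \<in> insert 0 ((\<lambda>i. h i y) ` I)" unfolding e_def \<phi>_def using fin by (intro Max_in) auto
    then have ex: "\<exists>i\<in>I. h i y = e" using e by auto
    obtain u where u: "norm u = 1" "u \<bullet> y = 0"
        "\<And>i. i \<in> I \<Longrightarrow> h i y = e \<Longrightarrow> g i y \<bullet> u < - (1 / c)"
      using slope[of y e] y1 d e er le ex by blast
    define \<gamma> where "\<gamma> t = cos t *\<^sub>R y + sin t *\<^sub>R u" for t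
    have \<gamma>0: "\<gamma> 0 = y" by (simp add: \<gamma>_def)
    \<comment> \<open>An active constraint decreases faster than \<open>t / c\<close> grows, by the
      slope condition; an inactive one stays below \<open>e\<close> by continuity.\<close>
    have ev: "eventually (\<lambda>t. h i (\<gamma> t) + t / c < e) (at_right 0)" if i: "i \<in> I" for i
    proof -
      have d\<gamma>: "(\<gamma> has_derivative (\<lambda>t. t *\<^sub>R u)) (at 0)"
        unfolding \<gamma>_def by (auto intro!: derivative_eq_intros)
      have "((\<lambda>t. h i (\<gamma> t)) has_derivative (\<lambda>t. g i y \<bullet> (t *\<^sub>R u))) (at 0)"
        by (rule has_derivative_compose[OF d\<gamma>]) (use der[OF i] \<gamma>0 in simp)
      then have "((\<lambda>t. h i (\<gamma> t)) has_real_derivative g i y \<bullet> u) (at 0)"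
        unfolding has_field_derivative_def by (rule has_derivative_eq_rhs) (auto simp: fun_eq_iff)
      then have dh: "((\<lambda>t. h i (\<gamma> t) + t / c) has_real_derivative g i y \<bullet> u + 1 / c) (at 0)"
        by (intro DERIV_add DERIV_cdivide DERIV_ident)
      show ?thesis
      proof (cases "h i y = e")
        case True
        have "g i y \<bullet> u + 1 / c < 0" using u(3)[OF i True] by simp
        from DERIV_neg_dec_right[OF dh this] obtain \<delta> where "\<delta> > 0"
          "\<And>t. t > 0 \<Longrightarrow> t < \<delta> \<Longrightarrow> h i (\<gamma> t) + t / c < h i (\<gamma> 0)" by auto
        then show ?thesis
          unfolding eventually_at_right_field using \<gamma>0 True by auto
      next
        case False
        then have "h i (\<gamma> 0) + 0 / c < e" using le[OF i] \<gamma>0 by simp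
        moreover have "((\<lambda>t. h i (\<gamma> t) + t / c) \<longlongrightarrow> h i (\<gamma> 0) + 0 / c) (at 0)"
          using DERIV_isCont[OF dh] by (simp add: isCont_def)
        ultimately have "eventually (\<lambda>t. h i (\<gamma> t) + t / c < e) (at 0)"
          by (rule order_tendstoD(2)[rotated])
        then show ?thesis by (rule filter_leD[OF at_le, rotated]) simp
      qed
    qed
    have "eventually (\<lambda>t. \<forall>i\<in>I. h i (\<gamma> t) + t / c < e) (at_right 0)"
      using fin ev by (intro eventually_ball_finite) auto
    \<comment> \<open>This handles the inserted 0 in the maximum: if \<phi> vanishes at the new
      point, \<open>t / c < e\<close> is still required.\<close>
    moreover have "eventually (\<lambda>t. t < c * e) (at_right 0)"
      using c e by (intro eventually_at_right_real[THEN eventually_mono, of 0 "c * e"]) auto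
    moreover have "eventually (\<lambda>t::real. t > 0) (at_right 0)" by (rule eventually_at_right_less)
    ultimately have "eventually (\<lambda>t. (\<forall>i\<in>I. h i (\<gamma> t) + t / c < e) \<and> t < c * e \<and> t > 0) (at_right 0)"
      by (intro eventually_conj)
    then obtain t where t: "\<And>i. i \<in> I \<Longrightarrow> h i (\<gamma> t) + t / c < e" "t < c * e" "t > 0"
      using eventually_happens'[OF trivial_limit_at_right_real] by blast
    have "\<phi> (\<gamma> t) \<in> insert 0 ((\<lambda>i. h i (\<gamma> t)) ` I)" unfolding \<phi>_def using fin by (intro Max_in) auto
    then have "\<phi> (\<gamma> t) + t / c < e" using t c by (auto simp: field_simps)
    moreover have "\<gamma> t \<in> sphere 0 1" "dist (\<gamma> t) y \<le> t"
      using great_circle[OF y1 u(1,2), of t] t(3) by (simp_all add: \<gamma>_def)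
    moreover have "dist (\<gamma> t) x \<le> dist (\<gamma> t) y + dist y x" by (rule dist_triangle)
    ultimately have "\<phi> (\<gamma> t) + dist (\<gamma> t) x / c < e + dist y x / c"
    proof -
      have "dist (\<gamma> t) x / c \<le> (t + dist y x) / c"
        using \<open>dist (\<gamma> t) y \<le> t\<close> \<open>dist (\<gamma> t) x \<le> _\<close> c by (intro divide_right_mono) auto
      then show ?thesis using \<open>\<phi> (\<gamma> t) + t / c < e\<close> by (simp add: add_divide_distrib)
    qed
    then show ?thesis using y(2)[OF \<open>\<gamma> t \<in> sphere 0 1\<close>] by (simp add: e_def)
  qed
qed

text \<open>
  The duality between common descent directions and convex combinations: the direction is
  opposite to the point of least norm of the convex hull.
\<close>

lemma common_descent_direction:
  fixes w :: "'i \<Rightarrow> 'a::euclidean_space"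
  assumes I: "finite I" "I \<noteq> {}" and s: "s > 0"
    and hull: "\<And>l. (\<And>i. i \<in> I \<Longrightarrow> l i \<ge> 0) \<Longrightarrow> sum l I = 1 \<Longrightarrow> s \<le> norm (\<Sum>i\<in>I. l i *\<^sub>R w i)"
  shows "\<exists>u. norm u = 1 \<and> u \<in> span (w ` I) \<and> (\<forall>i\<in>I. w i \<bullet> u \<le> - s)"
proof -
  \<comment> \<open>Combinations are indexed by \<open>I\<close>, since \<open>w\<close> may repeat
    values. The inclusion of the hull in \<open>T\<close> carries the lower bound \<open>s\<close>
    over to the hull.\<close>
  define T where "T = {\<Sum>i\<in>I. l i *\<^sub>R w i | l. (\<forall>i\<in>I. l i \<ge> 0) \<and> sum l I = (1::real)}"
  have "convex T"
  proof (rule convexI)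
    fix p q and a b :: real assume ab: "0 \<le> a" "0 \<le> b" "a + b = 1" and "p \<in> T" "q \<in> T"
    then obtain l m where l: "\<forall>i\<in>I. l i \<ge> 0" "sum l I = 1" "p = (\<Sum>i\<in>I. l i *\<^sub>R w i)"
      and m: "\<forall>i\<in>I. m i \<ge> 0" "sum m I = 1" "q = (\<Sum>i\<in>I. m i *\<^sub>R w i)"
      unfolding T_def by blast
    have "a *\<^sub>R p + b *\<^sub>R q = (\<Sum>i\<in>I. (a * l i + b * m i) *\<^sub>R w i)"
      by (simp add: l m scaleR_sum_right scaleR_add_left sum.distrib)
    moreover have "(\<Sum>i\<in>I. a * l i + b * m i) = 1"
      using l m ab by (simp add: sum.distrib sum_distrib_left[symmetric])
    ultimately show "a *\<^sub>R p + b *\<^sub>R q \<in> T"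
      unfolding T_def using l m ab by (intro CollectI exI[of _ "\<lambda>i. a * l i + b * m i"]) auto
  qed
  moreover have "w ` I \<subseteq> T"
  proof
    fix q assume "q \<in> w ` I"
    then obtain j where j: "j \<in> I" "q = w j" by blast
    have "(\<Sum>i\<in>I. (if i = j then 1 else 0) *\<^sub>R w i) = (\<Sum>i\<in>I. if i = j then w i else 0)"
      by (intro sum.cong) auto
    then show "q \<in> T"
      unfolding T_def using I j by (intro CollectI exI[of _ "\<lambda>i. if i = j then 1 else 0"]) auto
  qed
  ultimately have sub: "convex hull (w ` I) \<subseteq> T" by (intro hull_minimal) auto
  have comp: "compact (convex hull (w ` I))" using I by (intro compact_convex_hull finite_imp_compact) auto
  have ne: "convex hull (w ` I) \<noteq> {}" using I by auto
  define p where "p = closest_point (convex hull (w ` I)) 0"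
  have p: "p \<in> convex hull (w ` I)"
    unfolding p_def by (intro closest_point_in_set compact_imp_closed comp ne)
  \<comment> \<open>The variational inequality for the closest point to 0.\<close>
  have dot: "p \<bullet> p \<le> q \<bullet> p" if "q \<in> convex hull (w ` I)" for q
    using closest_point_dot[OF convex_convex_hull compact_imp_closed[OF comp] that, of 0]
    by (simp add: p_def inner_diff_right inner_commute)
  have sp: "s \<le> norm p" using p sub hull unfolding T_def by blast
  then have p0: "norm p > 0" using s by linarith
  show ?thesis
  proof (intro exI[of _ "- (p /\<^sub>R norm p)"] conjI ballI)
    show "norm (- (p /\<^sub>R norm p)) = 1" using p0 by simp
    \<comment> \<open>Membership in the span will make the direction tangent to the sphere when all
      \<open>w i\<close> are tangent.\<close>
    have "p \<in> span (w ` I)" using p convex_hull_subset_span by blast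
    then show "- (p /\<^sub>R norm p) \<in> span (w ` I)" by (intro span_neg span_scale)
    fix i assume "i \<in> I"
    then have "p \<bullet> p \<le> w i \<bullet> p" by (intro dot hull_inc) auto
    then have "norm p * norm p \<le> w i \<bullet> p" by (simp add: power2_norm_eq_inner[symmetric] power2_eq_square)
    then have "norm p \<le> (w i \<bullet> p) / norm p" using p0 by (simp add: le_divide_eq)
    then show "w i \<bullet> (- (p /\<^sub>R norm p)) \<le> - s" using sp by (simp add: field_simps)
  qed
qed

section \<open>Convex combinations of tangential gradients at a nearby point\<close>

lemma tangent_part_sum: "tangent_part y (\<Sum>i\<in>I. a i *\<^sub>R w i) = (\<Sum>i\<in>I. a i *\<^sub>R tangent_part y (w i))"
  by (simp add: tangent_part_def inner_sum_left scaleR_sum_left sum_subtractf scaleR_diff_right)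

context normalised_system
begin

text \<open>The combination is the tangent part of a weighted gradient at \<open>y\<close>. At
  \<open>x\<close> that gradient is bounded below by the singular value bound; moving to
  \<open>y\<close> costs \<open>D * sqrt D * norm (x - y)\<close> and removing the radial part costs
  \<open>sqrt D * e\<close>, all in units of \<open>Z * ?S\<close>.\<close>

lemma convex_combination_lower:
  assumes x: "norm x = 1" and y: "norm y = 1"
    and surj: "surj_on_coords (tangent_space x) (length M) (system_deriv M x)"
    and mu: "mu_proj M x \<le> ereal K" and K: "K > 0"
    and pos: "\<And>j. j < length M \<Longrightarrow> form_norm (M ! j) > 0"
    and sgn: "\<And>j. j < length M \<Longrightarrow> \<bar>\<sigma> j\<bar> = 1"
    and val: "value_norm M y \<le> e * system_norm M"
    and s: "0 \<le> s" "s \<le> 1 / K - D * sqrt D * norm (x - y) - sqrt D * e"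
    and l: "\<And>j. j < length M \<Longrightarrow> l j \<ge> 0" "(\<Sum>j<length M. l j) = 1"
  shows "s \<le> norm (\<Sum>j<length M. l j *\<^sub>R
    tangent_part y ((\<sigma> j / form_norm (M ! j)) *\<^sub>R form_gradient (M ! j) y))"
proof -
  let ?d = "\<lambda>j. real (fst (M ! j))" and ?S = "system_norm M"
  \<comment> \<open>The factor \<open>sqrt d\<close> cancels the weight in
    \<open>weighted_gradient\<close>.\<close>
  define z where "z j = l j * \<sigma> j * sqrt (?d j) / form_norm (M ! j)" for j
  define Z where "Z = L2_set z {..<length M}"
  have Z0: "Z \<ge> 0" by (simp add: Z_def L2_set_nonneg)
  define wx where "wx = weighted_gradient M x z"
  define wy where "wy = weighted_gradient M y z"
  have dpos: "?d j \<ge> 1" if "j < length M" for j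
    using surj_imp_degree_pos[OF x surj that] by simp
  have "wy = (\<Sum>j<length M. l j *\<^sub>R ((\<sigma> j / form_norm (M ! j)) *\<^sub>R form_gradient (M ! j) y))"
    unfolding wy_def weighted_gradient_def
    by (intro sum.cong) (use dpos in \<open>force simp: z_def\<close>)+
  then have eq: "(\<Sum>j<length M. l j *\<^sub>R
      tangent_part y ((\<sigma> j / form_norm (M ! j)) *\<^sub>R form_gradient (M ! j) y)) = tangent_part y wy"
    by (simp only: tangent_part_sum)
  \<comment> \<open>Cauchy-Schwarz, with the degrees at least 1, shows that the common unit
    \<open>Z * ?S\<close> is at least 1.\<close>
  have "1 = (\<Sum>j<length M. l j)" using l by simp
  also have "\<dots> \<le> (\<Sum>j<length M. \<bar>z j\<bar> * \<bar>form_norm (M ! j)\<bar>)"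
  proof (rule sum_mono)
    fix j assume "j \<in> {..<length M}"
    then have j: "j < length M" by simp
    have "l j * 1 \<le> l j * sqrt (?d j)" using l(1)[OF j] dpos[OF j] by (intro mult_left_mono) auto
    also have "\<dots> = \<bar>z j\<bar> * \<bar>form_norm (M ! j)\<bar>"
      using pos[OF j] sgn[OF j] l(1)[OF j] by (simp add: z_def abs_mult)
    finally show "l j \<le> \<bar>z j\<bar> * \<bar>form_norm (M ! j)\<bar>" by simp
  qed
  also have "\<dots> \<le> Z * ?S"
    unfolding Z_def system_norm_eq by (rule L2_set_mult_ineq)
  finally have ZS: "1 \<le> Z * ?S" .
  have "?S * Z \<le> K * norm (tangent_part x wx)"
    unfolding Z_def wx_def by (rule weighted_gradient_lower[OF x surj mu])
  also have "\<dots> \<le> K * norm wx"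
    using K norm_tangent_part_le[OF x] by (intro mult_left_mono) auto
  finally have 1: "(Z * ?S) * (1 / K) \<le> norm wx" using K by (simp add: field_simps)
  have 2: "norm (wx - wy) \<le> (Z * ?S) * (D * sqrt D * norm (x - y))"
    using weighted_gradient_diff_le[OF x y, of z] by (simp add: wx_def wy_def Z_def mult_ac)
  have "\<bar>wy \<bullet> y\<bar> \<le> sqrt D * Z * value_norm M y"
    unfolding wy_def Z_def by (rule weighted_gradient_radial)
  also have "\<dots> \<le> sqrt D * Z * (e * ?S)" using val D_ge_1 Z0 by (intro mult_left_mono) auto
  finally have 3: "\<bar>wy \<bullet> y\<bar> \<le> (Z * ?S) * (sqrt D * e)" by (simp add: mult_ac)
  have "norm wy \<le> norm (tangent_part y wy) + norm ((wy \<bullet> y) *\<^sub>R y)"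
    unfolding tangent_part_def by (metis add.commute diff_add_cancel norm_triangle_ineq)
  then have 4: "norm wy - \<bar>wy \<bullet> y\<bar> \<le> norm (tangent_part y wy)" using y by simp
  have 5: "norm wx - norm wy \<le> norm (wx - wy)" by (rule norm_triangle_ineq2)
  have "s * 1 \<le> (1 / K - D * sqrt D * norm (x - y) - sqrt D * e) * (Z * ?S)"
    using s ZS by (intro mult_mono) auto
  also have "\<dots> = (Z * ?S) * (1 / K) - (Z * ?S) * (D * sqrt D * norm (x - y)) - (Z * ?S) * (sqrt D * e)"
    by (simp add: algebra_simps)
  also have "\<dots> \<le> norm (tangent_part y wy)" using 1 2 3 4 5 by linarith
  finally show ?thesis by (simp add: eq)
qed

end

section \<open>Descent directions for nearly active constraints\<close>

lemma system_norm_pos: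
  assumes "M \<noteq> []" "\<And>f. f \<in> set M \<Longrightarrow> form_norm f > 0"
  shows "system_norm M > 0"
proof -
  have "form_norm (M ! 0) \<le> system_norm M"
    unfolding system_norm_eq by (rule member_le_L2_set) (use assms in auto)
  moreover have "form_norm (M ! 0) > 0" using assms by simp
  ultimately show ?thesis by linarith
qed

lemma value_norm_le:
  assumes "e \<ge> 0" "\<And>f. f \<in> set M \<Longrightarrow> \<bar>feval f y\<bar> \<le> e * form_norm f"
  shows "value_norm M y \<le> e * system_norm M"
proof -
  have "value_norm M y = L2_set (\<lambda>j. \<bar>feval (M ! j) y\<bar>) {..<length M}"
    by (simp add: value_norm_def L2_set_def)
  also have "\<dots> \<le> L2_set (\<lambda>j. e * form_norm (M ! j)) {..<length M}"
    by (rule L2_set_mono) (use assms in auto)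
  also have "\<dots> = e * system_norm M"
    using assms(1) by (simp add: system_norm_eq L2_set_right_distrib)
  finally show ?thesis .
qed

text \<open>The tangent space has dimension \<open>CARD('n) - 1\<close>. The coordinates are
  relabelled by a bijection with \<open>'n\<close> so that linear algebra in
  \<open>real ^ 'n\<close> applies.\<close>

lemma not_surj_on_coords_tangent_space:
  fixes x :: "real ^ 'n::finite"
  assumes x: "x \<noteq> 0" and lin: "\<And>j. j < CARD('n) \<Longrightarrow> linear (\<lambda>v. A v j)"
  shows "\<not> surj_on_coords (tangent_space x) (CARD('n)) A"
proof
  assume surj: "surj_on_coords (tangent_space x) (CARD('n)) A"
  obtain b :: "'n \<Rightarrow> nat" where b: "bij_betw b UNIV {0..<CARD('n)}"
    using ex_bij_betw_finite_nat[of "UNIV :: 'n set"] by auto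
  have bl: "b i < CARD('n)" for i using bij_betwE[OF b] by auto
  define T :: "real ^ 'n \<Rightarrow> real ^ 'n" where "T v = (\<chi> i. A v (b i))" for v
  have T: "linear T"
    by (rule linearI) (auto simp: T_def vec_eq_iff linear_add[OF lin[OF bl]] linear_scale[OF lin[OF bl]])
  have "w \<in> T ` tangent_space x" for w :: "real ^ 'n"
  proof -
    obtain v where v: "v \<in> tangent_space x" "\<And>j. j < CARD('n) \<Longrightarrow> A v j = w $ (inv b j)"
      using surj[unfolded surj_on_coords_def, rule_format, of "\<lambda>j. w $ inv b j"] by blast
    have "T v = w"
      using v(2)[OF bl] b by (simp add: T_def vec_eq_iff bij_betw_def inv_f_f)
    then show ?thesis using v by blast
  qed
  then have "T ` tangent_space x = UNIV" by auto
  then have "dim (UNIV :: (real ^ 'n) set) \<le> dim (tangent_space x)"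
    using dim_image_le[OF T, of "tangent_space x"] by simp
  moreover have "dim (tangent_space x) = DIM(real ^ 'n) - 1"
    unfolding tangent_space_def by (rule dim_hyperplane[OF x])
  moreover have "DIM(real ^ 'n) > 0" by (rule DIM_positive)
  moreover have "dim (UNIV :: (real ^ 'n) set) = DIM(real ^ 'n)" by (rule dim_UNIV)
  ultimately show False by linarith
qed

text \<open>Each form is taken with the sign of its value at \<open>y\<close>. The direction lies in
  the span of tangent vectors, so it is itself tangent, and pairing with it does not distinguish a
  gradient from its tangent part.\<close>

lemma (in normalised_system) common_descent:
  assumes x: "norm x = 1" and y: "norm y = 1" and M: "M \<noteq> []"
    and surj: "surj_on_coords (tangent_space x) (length M) (system_deriv M x)"
    and mu: "mu_proj M x \<le> ereal K" and K: "K > 0"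
    and pos: "\<And>f. f \<in> set M \<Longrightarrow> form_norm f > 0"
    and e: "e \<ge> 0" "\<And>f. f \<in> set M \<Longrightarrow> \<bar>feval f y\<bar> \<le> e * form_norm f"
    and s: "0 < s" "s \<le> 1 / K - D * sqrt D * norm (x - y) - sqrt D * e"
  shows "\<exists>u. norm u = 1 \<and> u \<bullet> y = 0 \<and> (\<forall>f\<in>set M. \<forall>a. \<bar>a\<bar> = 1 / form_norm f \<longrightarrow>
    0 < a * feval f y \<longrightarrow> (a *\<^sub>R form_gradient f y) \<bullet> u \<le> - s)"
proof -
  \<comment> \<open>At value 0 the sign defaults to -1; the claim concerns only \<open>a\<close> for
    which \<open>a * feval f y\<close> is positive.\<close>
  define \<sigma> :: "nat \<Rightarrow> real" where "\<sigma> j = (if feval (M ! j) y > 0 then 1 else - 1)" for j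
  define w where
    "w j = tangent_part y ((\<sigma> j / form_norm (M ! j)) *\<^sub>R form_gradient (M ! j) y)" for j
  have "\<exists>u. norm u = 1 \<and> u \<in> span (w ` {..<length M}) \<and> (\<forall>j\<in>{..<length M}. w j \<bullet> u \<le> - s)"
  proof (rule common_descent_direction)
    fix l :: "nat \<Rightarrow> real" assume l: "\<And>j. j \<in> {..<length M} \<Longrightarrow> 0 \<le> l j" "sum l {..<length M} = 1"
    show "s \<le> norm (\<Sum>j<length M. l j *\<^sub>R w j)"
      unfolding w_def
      by (rule convex_combination_lower[OF x y surj mu K _ _ value_norm_le[OF e] _ s(2)])
        (use pos l s in \<open>auto simp: \<sigma>_def\<close>)
  qed (use M s in auto)
  then obtain u where u: "norm u = 1" "u \<in> span (w ` {..<length M})"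
    "\<And>j. j < length M \<Longrightarrow> w j \<bullet> u \<le> - s" by auto
  have "y \<bullet> y = 1" using y by (simp add: norm_eq_1)
  then have "w j \<in> tangent_space y" for j
    by (simp add: w_def tangent_part_def tangent_space_def inner_diff_right inner_commute)
  then have "span (w ` {..<length M}) \<subseteq> tangent_space y"
    by (intro span_minimal subspace_tangent_space) auto
  then have uy: "u \<bullet> y = 0" using u(2) by (auto simp: tangent_space_def inner_commute)
  have "(a *\<^sub>R form_gradient f y) \<bullet> u \<le> - s"
    if "f \<in> set M" and a: "\<bar>a\<bar> = 1 / form_norm f" "0 < a * feval f y" for f a
  proof -
    obtain j where j: "j < length M" "f = M ! j" using \<open>f \<in> set M\<close> by (metis in_set_conv_nth)
    have "a = \<sigma> j / form_norm f"
      using a pos[OF that(1)] j(2) by (auto simp: \<sigma>_def zero_less_mult_iff abs_if split: if_splits)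
    then have "w j \<bullet> u = (a *\<^sub>R form_gradient f y) \<bullet> u"
      using uy j(2) by (simp add: w_def tangent_part_def inner_diff_left inner_diff_right inner_commute)
    then show ?thesis using u(3)[OF j(1)] by simp
  qed
  then show ?thesis using u(1) uy by blast
qed

text \<open>With \<open>q = sqrt D * k\<close> and \<open>p = D * k * r\<close>, the radius
  condition reads \<open>13 * (p * q) < 1\<close>. After multiplication by \<open>k\<close>, the
  second claim reduces to \<open>2 / 3 < 9 / 10 - 3 / 26 - 10 / 91\<close>, where the margin is
  below 1/100.\<close>

lemma radius_bounds:
  fixes D k r \<delta> e :: real
  assumes D: "D \<ge> 1" and k: "k > 0" "1 \<le> 2 * D * k\<^sup>2"
    and r: "0 < r" "13 * (D * sqrt D) * k\<^sup>2 * r < 1"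
    and \<delta>: "\<delta> < 3 / 2 * k * r" and e: "e < r"
  shows "4 * k * (r + D * \<delta>) \<le> 1"
    and "1 / (3 / 2 * k) < 1 / (10 / 9 * k) - D * sqrt D * \<delta> - sqrt D * e"
proof -
  define s where "s = sqrt D"
  have s: "s \<ge> 1" "D = s * s" using D by (auto simp: s_def)
  define q where "q = s * k"
  have "1 \<le> 2 * q\<^sup>2" using k(2) s by (simp add: q_def power2_eq_square mult_ac)
  have q0: "q > 0" using s k by (simp add: q_def)
  \<comment> \<open>A rational lower bound for \<open>1 / sqrt 2\<close>.\<close>
  have q: "q \<ge> 7 / 10"
  proof (rule ccontr)
    assume "\<not> q \<ge> 7 / 10"
    then have "q\<^sup>2 \<le> (7 / 10)\<^sup>2" using q0 by (intro power_mono) auto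
    then show False using \<open>1 \<le> 2 * q\<^sup>2\<close> by (simp add: power2_eq_square)
  qed
  define p where "p = D * (k * r)"
  have p0: "p > 0" using D k r by (simp add: p_def)
  have pq: "13 * (p * q) < 1" using r(2) by (simp add: p_def q_def s_def power2_eq_square mult_ac)
  have "p * (7 / 10) \<le> p * q" using q p0 by (intro mult_left_mono) auto
  then have p: "p \<le> 10 / 91" using pq by linarith
  have kr: "k * r \<le> p" using D k r by (simp add: p_def)
  have "k * p \<le> p * q" using s k p0 by (simp add: q_def mult_ac)
  then have kp: "k * p \<le> 1 / 13" using pq by linarith
  have "D * \<delta> \<le> D * (3 / 2 * k * r)" using \<delta> D by (intro mult_left_mono) auto
  then have "k * (D * \<delta>) \<le> k * (D * (3 / 2 * k * r))"
    by (rule mult_left_mono) (use k in simp)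
  also have "\<dots> = 3 / 2 * (k * p)" by (simp add: p_def mult_ac)
  finally show "4 * k * (r + D * \<delta>) \<le> 1"
    using kr kp p by (simp add: distrib_left mult.assoc)
  have "D * s * k * \<delta> \<le> D * s * k * (3 / 2 * k * r)"
    using \<delta> D k s by (intro mult_left_mono) auto
  also have "\<dots> = 3 / 2 * (p * q)" by (simp add: p_def q_def mult_ac)
  finally have 1: "D * s * k * \<delta> \<le> 3 / 26" using pq by linarith
  have "s * k * e \<le> s * k * r" using e s k by (intro mult_left_mono) auto
  also have "\<dots> \<le> (s * s) * (k * r)" using s k r by (simp add: mult.assoc)
  finally have 2: "s * k * e \<le> p" by (simp add: p_def s)
  have "k * (1 / (3 / 2 * k)) = 2 / 3" using k by simp
  also have "\<dots> < 9 / 10 - D * s * k * \<delta> - s * k * e" using 1 2 p by linarith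
  also have "\<dots> = k * (1 / (10 / 9 * k) - D * s * \<delta> - s * e)"
    using k by (simp add: algebra_simps)
  finally show "1 / (3 / 2 * k) < 1 / (10 / 9 * k) - D * sqrt D * \<delta> - sqrt D * e"
    using k by (simp only: mult_less_cancel_left_pos s_def)
qed

section \<open>Admissible subsystems and their condition numbers\<close>

lemma normalised_system_sublist:
  assumes "homogeneous_system N" "set M \<subseteq> set N" "max_degree N \<ge> 1"
  shows "normalised_system M (real (max_degree N))"
proof
  fix j assume "j < length M"
  then have j: "M ! j \<in> set N" using assms(2) nth_mem by blast
  then show "homogeneous_form (M ! j)"
    using assms(1) by (auto simp: homogeneous_system_def split: prod.splits)
  show "real (fst (M ! j)) \<le> real (max_degree N)"
    using j by (simp add: max_degree_def)
qed (use assms in simp)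

lemma finite_admissible: "finite (admissible F G)"
  by (rule finite_subset[of _ "Pow {..<length G}"]) (auto simp: admissible_def)

lemma kappa_at_le_kappa_pair_at:
  "L \<in> admissible F G \<Longrightarrow> kappa_at (F @ nths G L) x \<le> kappa_pair_at F G x"
  unfolding kappa_pair_at_def using finite_admissible by (intro Max_ge) auto

lemma length_append_nths:
  "L \<subseteq> {..<length G} \<Longrightarrow> length (F @ nths G L) = length F + card L"
  by (auto simp: length_nths intro!: arg_cong[of _ _ card])

lemma system_deriv_linear:
  assumes "homogeneous_form (M ! j)"
  shows "linear (\<lambda>v. system_deriv M x v j)"
  unfolding system_deriv_def inner_form_gradient[OF assms, symmetric]
  by (rule bounded_linear.linear[OF bounded_linear_inner_right])

text \<open>A form of norm 0 vanishes on the sphere, so the strict inequalities of the approximate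
  set would read 0 < 0.\<close>

lemma form_norm_pos_of_approx:
  assumes hom: "homogeneous_system (F @ G)" and x: "x \<in> approx_semialg_set F G r"
    and f: "f \<in> set (F @ G)"
  shows "form_norm f > 0"
proof (rule ccontr)
  assume "\<not> form_norm f > 0"
  then have 0: "form_norm f = 0" using form_norm_nonneg[of f] by linarith
  have "homogeneous_form f" using hom f by (auto simp: homogeneous_system_def split: prod.splits)
  then have "\<bar>feval f x\<bar> \<le> form_norm f"
    using x by (intro abs_feval_le) (auto simp: approx_semialg_set_def)
  then show False using x f 0 by (auto simp: approx_semialg_set_def)
qed

text \<open>
  The set L is admissible because \<open>CARD('n)\<close> nearly active constraints would have jointly
  surjective derivatives on a space of dimension \<open>CARD('n) - 1\<close>.
\<close>

lemma nearly_active_subsystem: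
  fixes F G :: "'n::finite system"
  assumes hom: "homogeneous_system (F @ G)" and D: "max_degree (F @ G) \<ge> 1"
    and lenF: "length F \<le> CARD('n)" and x: "norm x = 1"
    and pos: "\<And>f. f \<in> set (F @ G) \<Longrightarrow> form_norm f > 0"
    and k: "k > 0" "kappa_pair_at F G x \<le> ereal k"
    and \<eta>: "\<eta> \<ge> 0" "4 * k * \<eta> \<le> 1"
    and L: "L \<subseteq> {..<length G}" "F @ nths G L \<noteq> []"
    and near: "\<And>f. f \<in> set (F @ nths G L) \<Longrightarrow> \<bar>feval f x\<bar> \<le> \<eta> * form_norm f"
  shows "surj_on_coords (tangent_space x) (length (F @ nths G L)) (system_deriv (F @ nths G L) x)"
    and "mu_proj (F @ nths G L) x \<le> ereal (10 / 9 * k)"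
proof -
  have ns: "normalised_system (F @ nths G L') (real (max_degree (F @ G)))" for L'
    by (rule normalised_system_sublist[OF hom _ D]) (auto simp: set_nths)
  have *: "surj_on_coords (tangent_space x) (length (F @ nths G L')) (system_deriv (F @ nths G L') x)
      \<and> mu_proj (F @ nths G L') x \<le> ereal (10 / 9 * k)"
    if L': "L' \<subseteq> L" "length F + card L' \<le> CARD('n)" "F @ nths G L' \<noteq> []" for L'
  proof -
    let ?M = "F @ nths G L'"
    have sub: "set ?M \<subseteq> set (F @ nths G L)" "set ?M \<subseteq> set (F @ G)"
      using L'(1) by (auto simp: set_nths)
    have S: "system_norm ?M > 0" using sub(2) pos by (intro system_norm_pos L'(3)) auto
    have "value_norm ?M x \<le> \<eta> * system_norm ?M"
      using sub(1) near \<eta>(1) by (intro value_norm_le) auto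
    then have "4 * k * value_norm ?M x \<le> 4 * k * (\<eta> * system_norm ?M)"
      using k(1) by (intro mult_left_mono) auto
    also have "\<dots> = (4 * k * \<eta>) * system_norm ?M" by (simp add: mult_ac)
    also have "\<dots> \<le> 1 * system_norm ?M" using \<eta>(2) by (intro mult_right_mono) auto
    finally have v: "4 * k * value_norm ?M x \<le> system_norm ?M" by simp
    have "L' \<in> admissible F G" using L' L(1) by (auto simp: admissible_def)
    from order_trans[OF kappa_at_le_kappa_pair_at[OF this] k(2)]
    have "kappa_at ?M x \<le> ereal k" .
    from normalised_system.mu_proj_le_of_kappa_at[OF ns L'(3) S k(1) this v]
    show ?thesis by blast
  qed
  have "length F + card L \<le> CARD('n)"
  proof (rule ccontr)
    assume "\<not> ?thesis"
    then have "CARD('n) - length F \<le> card L" by simp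
    \<comment> \<open>Together with F this makes exactly \<open>CARD('n)\<close> members, as many as
      still satisfy admissibility and one more than the tangent space allows.\<close>
    then obtain L' where L': "L' \<subseteq> L" "card L' = CARD('n) - length F"
      using obtain_subset_with_card_n by metis
    let ?M = "F @ nths G L'"
    have len: "length ?M = CARD('n)"
      using length_append_nths[of L' G F] L' L(1) lenF by auto
    then have "?M \<noteq> []" by (metis list.size(3) zero_less_card_finite less_irrefl)
    then have "surj_on_coords (tangent_space x) (length ?M) (system_deriv ?M x)"
      using * L' lenF by simp
    moreover have "linear (\<lambda>v. system_deriv ?M x v j)" if "j < CARD('n)" for j
      using that len by (intro system_deriv_linear normalised_system.hom[OF ns]) simp
    moreover have "x \<noteq> 0" using x by auto
    ultimately show False
      using not_surj_on_coords_tangent_space[of x "system_deriv ?M x"] len by simp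
  qed
  then show "surj_on_coords (tangent_space x) (length (F @ nths G L)) (system_deriv (F @ nths G L) x)"
    and "mu_proj (F @ nths G L) x \<le> ereal (10 / 9 * k)"
    using *[of L] L(2) by auto
qed

text \<open>One nonempty admissible subsystem suffices: F itself, or a single inequality if F is
  empty, since the empty system has condition number 0.\<close>

lemma kappa_pair_at_ge:
  fixes F G :: "'n::finite system"
  assumes hom: "homogeneous_system (F @ G)" and D: "max_degree (F @ G) \<ge> 1"
    and lenF: "length F \<le> CARD('n)" and G: "G \<noteq> []" and x: "norm x = 1"
    and pos: "\<And>f. f \<in> set (F @ G) \<Longrightarrow> form_norm f > 0"
  shows "ereal (1 / sqrt (real (max_degree (F @ G)) + 1)) \<le> kappa_pair_at F G x"
proof -
  define L :: "nat set" where "L = (if F = [] then {0} else {})"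
  have sub: "L \<subseteq> {..<length G}" using G by (auto simp: L_def)
  have "CARD('n) \<ge> 1" by (simp add: Suc_leI)
  then have adm: "L \<in> admissible F G" using lenF sub by (auto simp: admissible_def L_def)
  let ?M = "F @ nths G L"
  have ne: "?M \<noteq> []"
  proof -
    have "length ?M > 0" using length_append_nths[OF sub, of F] by (auto simp: L_def)
    then show ?thesis by force
  qed
  have M: "set ?M \<subseteq> set (F @ G)" by (auto simp: set_nths)
  interpret normalised_system ?M "real (max_degree (F @ G))"
    by (rule normalised_system_sublist[OF hom M D])
  have "ereal (1 / sqrt (real (max_degree (F @ G)) + 1)) \<le> kappa_at ?M x"
    using M pos by (intro kappa_at_ge x ne system_norm_pos) auto
  also have "\<dots> \<le> kappa_pair_at F G x" by (rule kappa_at_le_kappa_pair_at[OF adm])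
  finally show ?thesis .
qed

text \<open>The error bound on the sphere is used with \<open>c = 3 / 2 * k\<close>; its slope
  condition comes from the members of F and the active inequalities, whose condition is known at
  \<open>x\<close>.\<close>

lemma exists_near_solution:
  fixes F G :: "'n::finite system"
  assumes hom: "homogeneous_system (F @ G)" and lenF: "length F \<le> CARD('n)"
    and D: "D = real (max_degree (F @ G))" "max_degree (F @ G) \<ge> 1"
    and x: "x \<in> approx_semialg_set F G r" and r: "r > 0"
    and k: "k > 0" "1 \<le> 2 * D * k\<^sup>2" "kappa_pair_at F G x \<le> ereal k"
    and small: "13 * (D * sqrt D) * k\<^sup>2 * r < 1"
  shows "\<exists>y\<in>semialg_set F G. dist y x < 3 / 2 * k * r"
proof -
  have x1: "norm x = 1" using x by (simp add: approx_semialg_set_def)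
  have D1: "D \<ge> 1" using D by simp
  have pos: "form_norm f > 0" if "f \<in> set (F @ G)" for f
    by (rule form_norm_pos_of_approx[OF hom x that])
  have homf: "homogeneous_form f" if "f \<in> set (F @ G)" for f
    using hom that by (auto simp: homogeneous_system_def split: prod.splits)
  \<comment> \<open>The pair \<open>(a, f)\<close> stands for the normalised constraint \<open>a f \<le> 0\<close>; an equation gives two.\<close>
  define I where "I = (\<lambda>f. (1 / form_norm f, f)) ` set F \<union> (\<lambda>f. (- 1 / form_norm f, f)) ` set (F @ G)"
  define h :: "real \<times> 'n form \<Rightarrow> real ^ 'n \<Rightarrow> real" where "h i y = fst i * feval (snd i) y" for i y
  define g :: "real \<times> 'n form \<Rightarrow> real ^ 'n \<Rightarrow> real ^ 'n"
    where "g i y = fst i *\<^sub>R form_gradient (snd i) y" for i y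
  have inI: "snd i \<in> set (F @ G)" "\<bar>fst i\<bar> = 1 / form_norm (snd i)" if "i \<in> I" for i
    using that by (auto simp: I_def)
  have "\<exists>y. norm y = 1 \<and> dist y x < (3 / 2 * k) * r \<and> (\<forall>i\<in>I. h i y \<le> 0)"
  proof (rule sphere_error_bound[where g = g])
    show "finite I" by (simp add: I_def)
    show "(h i has_derivative (\<lambda>v. g i y \<bullet> v)) (at y)" if "i \<in> I" for i y
      unfolding h_def g_def inner_scaleR_left
      using has_derivative_feval[OF homf[OF inI(1)[OF that]]] by (rule has_derivative_mult_right)
    show "h i x < r" if "i \<in> I" for i
      using that x pos by (auto simp: I_def h_def approx_semialg_set_def field_simps abs_less_iff)
    fix y :: "real ^ 'n" and e
    assume y: "norm y = 1" "dist y x < 3 / 2 * k * r" and e: "0 < e" "e < r"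
      and le: "\<And>i. i \<in> I \<Longrightarrow> h i y \<le> e" and ex: "\<exists>i\<in>I. h i y = e"
    define \<delta> where "\<delta> = norm (x - y)"
    have \<delta>: "\<delta> < 3 / 2 * k * r" using y(2) by (simp add: \<delta>_def dist_norm norm_minus_commute)
    note bounds = radius_bounds[OF D1 k(1,2) r small \<delta> e(2)]
    \<comment> \<open>All equations are kept, whether active or not, since their values at
      \<open>y\<close> are at most \<open>e\<close> times their norms anyway; an inequality enters
      only if its violation is exactly \<open>e\<close>.\<close>
    define L where "L = {j. j < length G \<and> - feval (G ! j) y = e * form_norm (G ! j)}"
    let ?M = "F @ nths G L"
    have setM: "set ?M = set F \<union> {f \<in> set G. - feval f y = e * form_norm f}"
      by (auto simp: L_def set_nths in_set_conv_nth) metis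
    have subM: "set ?M \<subseteq> set (F @ G)" by (auto simp: set_nths)
    have active: "snd i \<in> set ?M" if i: "i \<in> I" and eq: "h i y = e" for i
    proof (cases "snd i \<in> set F")
      case False
      then obtain f where f: "i = (- 1 / form_norm f, f)" "f \<in> set G"
        using i by (auto simp: I_def)
      then have "- feval f y = e * form_norm f"
        using eq pos[of f] by (auto simp: h_def field_simps)
      then show ?thesis unfolding setM using f by simp
    qed (simp add: setM)
    have ne: "?M \<noteq> []" using ex active by fastforce
    have near_y: "\<bar>feval f y\<bar> \<le> e * form_norm f" if f: "f \<in> set ?M" for f
    proof (cases "f \<in> set F")
      case True
      then have "(1 / form_norm f, f) \<in> I" "(- 1 / form_norm f, f) \<in> I" by (auto simp: I_def)
      from le[OF this(1)] le[OF this(2)] show ?thesis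
        using pos[of f] True by (auto simp: h_def field_simps abs_le_iff)
    next
      case False
      then have "- feval f y = e * form_norm f" using f False unfolding setM by simp
      moreover have "e * form_norm f \<ge> 0" using e(1) by simp
      ultimately show ?thesis by linarith
    qed
    \<comment> \<open>The condition number is given at \<open>x\<close>, so smallness is carried
      back from \<open>y\<close> by the Lipschitz bound for values.\<close>
    have near_x: "\<bar>feval f x\<bar> \<le> (r + D * \<delta>) * form_norm f" if f: "f \<in> set ?M" for f
    proof -
      have fFG: "f \<in> set (F @ G)" using subM f by blast
      then have deg: "real (fst f) \<le> D" using D by (simp add: max_degree_def)
      have "\<bar>feval f x - feval f y\<bar> \<le> real (fst f) * form_norm f * \<delta>"
        unfolding \<delta>_def by (rule feval_diff_le[OF homf[OF fFG] x1 y(1)])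
      also have "\<dots> \<le> D * form_norm f * \<delta>" using deg by (intro mult_right_mono) (auto simp: \<delta>_def)
      finally have "\<bar>feval f x\<bar> \<le> e * form_norm f + D * form_norm f * \<delta>" using near_y[OF f] by linarith
      also have "\<dots> \<le> r * form_norm f + D * form_norm f * \<delta>"
        using e(2) by (simp add: mult_right_mono)
      finally show ?thesis by (simp add: algebra_simps)
    qed
    have \<eta>: "r + D * \<delta> \<ge> 0" using r D1 by (simp add: \<delta>_def)
    have L: "L \<subseteq> {..<length G}" by (auto simp: L_def)
    have sub: "surj_on_coords (tangent_space x) (length ?M) (system_deriv ?M x)"
        "mu_proj ?M x \<le> ereal (10 / 9 * k)"
      by (rule nearly_active_subsystem[OF hom D(2) lenF x1 _ k(1,3) \<eta> bounds(1) L ne];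
          erule pos near_x)+
    interpret normalised_system ?M D
      unfolding D(1) by (rule normalised_system_sublist[OF hom subM D(2)])
    define s where "s = 1 / (10 / 9 * k) - D * sqrt D * \<delta> - sqrt D * e"
    have s: "1 / (3 / 2 * k) < s" using bounds(2) by (simp add: s_def)
    have "0 < 1 / (3 / 2 * k)" using k(1) by simp
    then have s0: "0 < s" using s by linarith
    have "\<exists>u. norm u = 1 \<and> u \<bullet> y = 0 \<and> (\<forall>f\<in>set ?M. \<forall>a. \<bar>a\<bar> = 1 / form_norm f \<longrightarrow>
        0 < a * feval f y \<longrightarrow> (a *\<^sub>R form_gradient f y) \<bullet> u \<le> - s)"
    proof (rule common_descent[OF x1 y(1) ne sub _ _ _ near_y s0])
      show "s \<le> 1 / (10 / 9 * k) - D * sqrt D * norm (x - y) - sqrt D * e"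
        by (simp add: s_def \<delta>_def)
    qed (use k(1) e pos subM in auto)
    then obtain u where u: "norm u = 1" "u \<bullet> y = 0" "\<And>f a. f \<in> set ?M \<Longrightarrow> \<bar>a\<bar> = 1 / form_norm f \<Longrightarrow>
        0 < a * feval f y \<Longrightarrow> (a *\<^sub>R form_gradient f y) \<bullet> u \<le> - s" by blast
    have "g i y \<bullet> u < - (1 / (3 / 2 * k))" if "i \<in> I" "h i y = e" for i
    proof -
      have "g i y \<bullet> u \<le> - s"
        unfolding g_def using that e(1) by (intro u(3) active inI) (auto simp: h_def)
      then show ?thesis using s by linarith
    qed
    then show "\<exists>u. norm u = 1 \<and> u \<bullet> y = 0 \<and> (\<forall>i\<in>I. h i y = e \<longrightarrow> g i y \<bullet> u < - (1 / (3 / 2 * k)))"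
      using u by blast
  qed (use x1 k r in auto)
  then obtain y where y: "norm y = 1" "dist y x < 3 / 2 * k * r" "\<And>i. i \<in> I \<Longrightarrow> h i y \<le> 0" by auto
  have sign: "feval f y \<ge> 0" if "f \<in> set (F @ G)" for f
  proof -
    have "(- 1 / form_norm f, f) \<in> I" using that by (auto simp: I_def)
    from y(3)[OF this] show ?thesis using pos[OF that] by (simp add: h_def field_simps)
  qed
  have "feval f y \<le> 0" if "f \<in> set F" for f
  proof -
    have "(1 / form_norm f, f) \<in> I" using that by (auto simp: I_def)
    from y(3)[OF this] show ?thesis using pos[of f] that by (simp add: h_def field_simps)
  qed
  then have "y \<in> semialg_set F G" using sign y(1) by (auto simp: semialg_set_def intro: order_antisym)
  then show ?thesis using y(2) by blast
qed

theorem theorem3p23: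
  fixes F G :: "'n::finite system" and x :: "real ^ 'n" and r :: real and D :: nat and B :: real
  assumes "homogeneous_system (F @ G)"
    and "length F \<le> CARD('n)"
    and "G \<noteq> []"
    and "D = max_degree (F @ G)"
    and "D \<ge> 1"
    and "kappa_star F G < \<infinity>"
    and "B = (\<Sum>i<length G. (4 * real D) ^ i)"
    and "x \<in> sphere 0 1"
    and "0 < r"
    and "ereal r < 1 / (ereal (13 * real D powr (3/2)) * (kappa_pair_at F G x)\<^sup>2)"
    and "x \<in> approx_semialg_set F G r"
  shows "sphere_setdist x (semialg_set F G) < 3 * ereal B * kappa_pair_at F G x * ereal r"
proof -
  note hom = assms(1) and r = assms(9)
  have x1: "norm x = 1" using assms(8) by simp
  have D: "max_degree (F @ G) \<ge> 1" "real D = real (max_degree (F @ G))" using assms(4,5) by auto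
  have D1: "real D \<ge> 1" using assms(5) by simp
  have pos: "form_norm f > 0" if "f \<in> set (F @ G)" for f
    by (rule form_norm_pos_of_approx[OF hom assms(11) that])
  \<comment> \<open>This makes the condition number positive and supplies the inequality
    \<open>1 \<le> 2 * D * k\<^sup>2\<close> for the numerical estimates.\<close>
  have ge: "ereal (1 / sqrt (real D + 1)) \<le> kappa_pair_at F G x"
    unfolding D(2) by (rule kappa_pair_at_ge[OF hom D(1) assms(2,3) x1 pos])
  have powr: "real D powr (3/2) = real D * sqrt (real D)"
  proof -
    have "real D powr (1 + 1/2) = real D * sqrt (real D)"
      unfolding powr_add using D1 by (simp add: powr_half_sqrt)
    then show ?thesis by simp
  qed
  \<comment> \<open>An infinite value would turn the radius condition into
    \<open>r < 0\<close>.\<close>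
  have "kappa_pair_at F G x \<noteq> \<infinity>"
  proof
    assume "kappa_pair_at F G x = \<infinity>"
    then have "ereal (13 * real D powr (3/2)) * (kappa_pair_at F G x)\<^sup>2 = \<infinity>"
      using D1 by (simp add: power2_eq_square powr)
    then show False using assms(10) r by simp
  qed
  then obtain k where k: "kappa_pair_at F G x = ereal k"
    using ge by (cases "kappa_pair_at F G x") auto
  have k1: "1 / sqrt (real D + 1) \<le> k" using ge k by simp
  have "0 < 1 / sqrt (real D + 1)" by simp
  then have k0: "k > 0" using k1 by linarith
  have "(1 / sqrt (real D + 1))\<^sup>2 \<le> k\<^sup>2" using k1 by (intro power_mono) auto
  then have "1 \<le> (real D + 1) * k\<^sup>2" by (simp add: power_divide field_simps)
  also have "\<dots> \<le> 2 * real D * k\<^sup>2" using D1 by (intro mult_right_mono) auto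
  finally have k2: "1 \<le> 2 * real D * k\<^sup>2" .
  define a where "a = 13 * (real D * sqrt (real D)) * k\<^sup>2"
  have a0: "a > 0" using D1 k0 by (simp add: a_def)
  have "ereal (13 * real D powr (3/2)) * (kappa_pair_at F G x)\<^sup>2 = ereal a"
    by (simp add: k powr a_def power2_eq_square)
  then have "ereal r < 1 / ereal a" using assms(10) by simp
  then have "r < 1 / a" using a0 by (simp add: one_ereal_def)
  then have "a * r < 1" using a0 by (simp add: field_simps)
  then have small: "13 * (real D * sqrt (real D)) * k\<^sup>2 * r < 1" by (simp only: a_def)
  obtain y where y: "y \<in> semialg_set F G" "dist y x < 3 / 2 * k * r"
    using exists_near_solution[OF hom assms(2) D(2,1) assms(11) r k0 k2 _ small] k by auto
  have "sphere_dist x y \<le> 2 * norm (x - y)"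
    using y(1) x1 by (intro sphere_dist_le) (auto simp: semialg_set_def)
  also have "\<dots> < 3 * k * r" using y(2) by (simp add: dist_norm norm_minus_commute)
  \<comment> \<open>The summand of \<open>B\<close> at \<open>i = 0\<close> is 1; it occurs because
    G is nonempty.\<close>
  also have "\<dots> \<le> 3 * B * k * r"
  proof -
    have "(4 * real D) ^ 0 \<le> B"
      unfolding assms(7) using assms(3) by (intro member_le_sum) auto
    then show ?thesis using k0 r by (intro mult_right_mono) auto
  qed
  finally have "ereal (sphere_dist x y) < 3 * ereal B * kappa_pair_at F G x * ereal r"
    by (simp add: k)
  moreover have "sphere_setdist x (semialg_set F G) \<le> ereal (sphere_dist x y)"
    unfolding sphere_setdist_def using y(1) by (rule INF_lower)
  ultimately show ?thesis by (rule le_less_trans[rotated])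
qed

end
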